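(* Let $X$ be a Banach space. The following are equivalent: (1) The ultrapower $(X)_{\mathcal U}$ has the slice-D2P for every free ultrafilter $\mathcal U$ over $\mathbb N$. (2) For every $0<\alpha<2$, $\lim_{n\rightarrow\infty} C_n^\alpha(X)=0$.
   Context: Banach spaces are over the scalar field $\mathbb R$ or $\mathbb C$ and are assumed non-zero. For a Banach space $X$, $B_X$ and $S_X$ denote the closed unit ball and the unit sphere, and $X^*$ the topological dual. A slice of $B_X$ is a set of the form $\{x\in B_X: \operatorname{Re} f(x)>\sup_{y\in B_X} \operatorname{Re} f(y)-\beta\}$ with $f\in X^*$ and $\beta>0$. $X$ has the slice diameter two property (slice-D2P) if every slice of $B_X$ has diameter exactly two. For $n\in\mathbb N$ and a subset $C$ of $X$, $\operatorname{conv}_n(C):=\{\sum_{i=1}^n\lambda_i x_i: \lambda_1,\ldots,\lambda_n\in[0,1],\ \sum_{i=1}^n\lambda_i=1,\ x_1,\ldots,x_n\in C\}$. For $\alpha>0$ and $n\in\mathbb N$ put $$S^\alpha(X):=\left\{\tfrac{x+y}{2}: x,y\in B_X,\ \Vert x-y\Vert\geq\alpha\right\},\qquad S_n^\alpha(X):=\operatorname{conv}_n(S^\alpha(X)),$$ $$C_n^\alpha(X):=\sup_{x\in S_X}\ \inf_{y\in S_n^\alpha(X)}\Vert x-y\Vert.$$ For a free ultrafilter $\mathcal U$ over $\mathbb N$, the ultrapower $(X)_{\mathcal U}$ is the quotient of the Banach space of bounded sequences in $X$ (sup norm) by the closed subspace of those sequences $(x_n)$ with $\lim_{\mathcal U}\Vert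 x_n\Vert=0$; its norm satisfies $\Vert(x_n)_{\mathcal U}\Vert=\lim_{\mathcal U}\Vert x_n\Vert$. *)

theory Defs
  imports "HOL-Analysis.Analysis"
begin

text \<open>
  The scalar field is a set \<open>K\<close> of complex numbers, equal to the reals or to the whole plane.
  Scalar multiplication is a function on all complex numbers, but only its values at scalars
  in \<open>K\<close> are constrained or used; at real scalars it is the multiplication of the class
  \<^class>\<open>banach\<close>. Thus for \<open>K = \<real>\<close> any real Banach space is covered.
\<close>

locale banach_over =
  fixes K :: "complex set" and smul :: "complex \<Rightarrow> 'a::banach \<Rightarrow> 'a"
  assumes scalars: "K = \<real> \<or> K = UNIV"
    and nonzero: "\<exists>x::'a. x \<noteq> 0"
    and smul_of_real: "smul (of_real r) x = r *\<^sub>R x"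
    and smul_add_right: "c \<in> K \<Longrightarrow> smul c (x + y) = smul c x + smul c y"
    and smul_add_left: "c \<in> K \<Longrightarrow> d \<in> K \<Longrightarrow> smul (c + d) x = smul c x + smul d x"
    and smul_smul: "c \<in> K \<Longrightarrow> d \<in> K \<Longrightarrow> smul c (smul d x) = smul (c * d) x"
    and norm_smul: "c \<in> K \<Longrightarrow> norm (smul c x) = cmod c * norm x"

lemma banach_over_real:
  assumes "\<exists>x::'a::banach. x \<noteq> 0"
  shows "banach_over \<real> (\<lambda>c x::'a. Re c *\<^sub>R x)"
  using assms
  by unfold_locales (auto simp: scaleR_add_right scaleR_add_left elim!: Reals_cases)

text \<open>
  The ultrapower depends on an ultrafilter and so cannot be a type; it is therefore represented
  as a normed space with an explicit carrier.
\<close>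

record 'v normed_structure =
  vectors :: "'v set"
  vadd :: "'v \<Rightarrow> 'v \<Rightarrow> 'v"
  vscale :: "complex \<Rightarrow> 'v \<Rightarrow> 'v"
  vnorm :: "'v \<Rightarrow> real"

definition unit_ball :: "'v normed_structure \<Rightarrow> 'v set" where
  "unit_ball Y = {y \<in> vectors Y. vnorm Y y \<le> 1}"

definition dual_space :: "complex set \<Rightarrow> 'v normed_structure \<Rightarrow> ('v \<Rightarrow> complex) set" where
  "dual_space K Y = {f.
     (\<forall>x\<in>vectors Y. f x \<in> K) \<and>
     (\<forall>x\<in>vectors Y. \<forall>y\<in>vectors Y. f (vadd Y x y) = f x + f y) \<and>
     (\<forall>c\<in>K. \<forall>x\<in>vectors Y. f (vscale Y c x) = c * f x) \<and>
     (\<exists>B. \<forall>x\<in>vectors Y. cmod (f x) \<le> B * vnorm Y x)}"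

definition slice :: "'v normed_structure \<Rightarrow> ('v \<Rightarrow> complex) \<Rightarrow> real \<Rightarrow> 'v set" where
  "slice Y f \<beta> = {x \<in> unit_ball Y. Re (f x) > (SUP y\<in>unit_ball Y. Re (f y)) - \<beta>}"

definition vdiameter :: "'v normed_structure \<Rightarrow> 'v set \<Rightarrow> real" where
  "vdiameter Y S = (SUP (x, y)\<in>S \<times> S. vnorm Y (vadd Y x (vscale Y (- 1) y)))"

definition slice_D2P :: "complex set \<Rightarrow> 'v normed_structure \<Rightarrow> bool" where
  "slice_D2P K Y \<longleftrightarrow> (\<forall>f\<in>dual_space K Y. \<forall>\<beta>>0. vdiameter Y (slice Y f \<beta>) = 2)"

definition free_ultrafilter :: "nat filter \<Rightarrow> bool" where
  "free_ultrafilter U \<longleftrightarrow>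
     U \<noteq> bot \<and>
     (\<forall>P. eventually P U \<or> eventually (\<lambda>n. \<not> P n) U) \<and>
     (\<forall>P. eventually P U \<longrightarrow> infinite {n. P n})"

text \<open>
  Since \<^typ>\<open>nat\<close> is discrete, \<^typ>\<open>nat \<Rightarrow>\<^sub>C 'a\<close> is the Banach space of all bounded sequences with
  the supremum norm.
\<close>

definition null_seqs :: "nat filter \<Rightarrow> (nat \<Rightarrow>\<^sub>C 'a::banach) set" where
  "null_seqs U = {x. ((\<lambda>n. norm (apply_bcontfun x n)) \<longlongrightarrow> 0) U}"

definition null_class :: "nat filter \<Rightarrow> (nat \<Rightarrow>\<^sub>C 'a::banach) \<Rightarrow> (nat \<Rightarrow>\<^sub>C 'a) set" where
  "null_class U x = {y. y - x \<in> null_seqs U}"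

definition seq_scale ::
  "(complex \<Rightarrow> 'a \<Rightarrow> 'a) \<Rightarrow> complex \<Rightarrow> (nat \<Rightarrow>\<^sub>C 'a::banach) \<Rightarrow> (nat \<Rightarrow>\<^sub>C 'a)" where
  "seq_scale smul c x = Bcontfun (\<lambda>n. smul c (apply_bcontfun x n))"

text \<open>
  The quotient by \<^const>\<open>null_seqs\<close>, whose points are cosets, with the quotient norm.
\<close>

definition ultrapower ::
  "(complex \<Rightarrow> 'a \<Rightarrow> 'a) \<Rightarrow> nat filter \<Rightarrow> (nat \<Rightarrow>\<^sub>C 'a::banach) set normed_structure" where
  "ultrapower smul U =
     \<lparr>vectors = range (null_class U),
      vadd = (\<lambda>A B. \<Union>x\<in>A. \<Union>y\<in>B. null_class U (x + y)),
      vscale = (\<lambda>c A. \<Union>x\<in>A. null_class U (seq_scale smul c x)),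
      vnorm = (\<lambda>A. INF x\<in>A. norm x)\<rparr>"

definition conv_n :: "nat \<Rightarrow> 'a::real_vector set \<Rightarrow> 'a set" where
  "conv_n n C = {\<Sum>i=1..n. l i *\<^sub>R x i | (l :: nat \<Rightarrow> real) x.
     (\<forall>i\<in>{1..n}. l i \<in> {0..1}) \<and> (\<Sum>i=1..n. l i) = 1 \<and> (\<forall>i\<in>{1..n}. x i \<in> C)}"

definition S_set :: "real \<Rightarrow> 'a::real_normed_vector set" where
  "S_set \<alpha> = {(1/2) *\<^sub>R (x + y) | x y. x \<in> cball 0 1 \<and> y \<in> cball 0 1 \<and> norm (x - y) \<ge> \<alpha>}"

definition C_const :: "'a::real_normed_vector itself \<Rightarrow> real \<Rightarrow> nat \<Rightarrow> real" where
  "C_const _ \<alpha> n = (SUP x\<in>(sphere 0 1 :: 'a set). INF y\<in>conv_n n (S_set \<alpha>). norm (x - y))"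


text \<open>The operations of the ultrapower computed on representatives.\<close>

lemma null_seqs_0: "0 \<in> null_seqs U"
  by (simp add: null_seqs_def)

lemma null_seqs_add: "x \<in> null_seqs U \<Longrightarrow> y \<in> null_seqs U \<Longrightarrow> x + y \<in> null_seqs U"
  unfolding null_seqs_def mem_Collect_eq tendsto_norm_zero_iff
  using tendsto_add_zero by fastforce

lemma null_seqs_minus: "x \<in> null_seqs U \<Longrightarrow> - x \<in> null_seqs U"
  by (simp add: null_seqs_def)

lemma self_mem_null_class: "x \<in> null_class U x"
  by (simp add: null_class_def null_seqs_0)

lemma null_class_ne: "null_class U x \<noteq> {}"
  using self_mem_null_class by blast

lemma null_class_eq_iff: "null_class U x = null_class U y \<longleftrightarrow> x - y \<in> null_seqs U"
proof
  assume "null_class U x = null_class U y"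
  then show "x - y \<in> null_seqs U"
    using self_mem_null_class[of x U] by (auto simp: null_class_def)
next
  assume *: "x - y \<in> null_seqs U"
  have "z - x \<in> null_seqs U \<longleftrightarrow> z - y \<in> null_seqs U" for z
    using null_seqs_add[OF _ *, of "z - x"]
      null_seqs_add[OF _ null_seqs_minus[OF *], of "z - y"] by auto
  then show "null_class U x = null_class U y"
    by (simp add: null_class_def)
qed

lemma vadd_ultrapower:
  "vadd (ultrapower smul U) (null_class U x) (null_class U y) = null_class U (x + y)"
proof -
  have "null_class U (x' + y') = null_class U (x + y)"
    if "x' \<in> null_class U x" "y' \<in> null_class U y" for x' y'
    using null_seqs_add[of "x' - x" U "y' - y"] that
    by (simp add: null_class_eq_iff) (simp add: null_class_def algebra_simps)
  then show ?thesis
    by (simp add: ultrapower_def null_class_ne cong: SUP_cong)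
qed

context banach_over
begin

lemma seq_scale_apply:
  fixes x :: "nat \<Rightarrow>\<^sub>C 'a"
  assumes "c \<in> K"
  shows "seq_scale smul c x n = smul c (x n)"
proof -
  have "(\<lambda>n. smul c (x n)) \<in> bcontfun"
  proof (rule bcontfun_normI)
    show "norm (smul c (x n)) \<le> cmod c * norm x" for n
      by (simp add: norm_smul assms mult_left_mono norm_bounded)
  qed simp
  then show ?thesis
    by (simp add: seq_scale_def Bcontfun_inverse)
qed

lemma vscale_ultrapower:
  fixes x :: "nat \<Rightarrow>\<^sub>C 'a"
  assumes "c \<in> K"
  shows "vscale (ultrapower smul U) c (null_class U x) = null_class U (seq_scale smul c x)"
proof -
  have smul_diff: "smul c (a - b) = smul c a - smul c b" for a b
    using smul_add_right[OF assms, of "a - b" b] by (simp add: algebra_simps)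
  have "null_class U (seq_scale smul c x') = null_class U (seq_scale smul c x)"
    if "x' \<in> null_class U x" for x'
  proof -
    have "((\<lambda>n. norm (x' n - x n)) \<longlongrightarrow> 0) U"
      using that by (simp add: null_class_def null_seqs_def)
    then have "((\<lambda>n. cmod c * norm (x' n - x n)) \<longlongrightarrow> 0) U"
      by (rule tendsto_mult_right_zero)
    then show ?thesis
      using assms by (simp add: null_class_eq_iff null_seqs_def seq_scale_apply
          flip: smul_diff norm_smul)
  qed
  then show ?thesis
    by (simp add: ultrapower_def null_class_ne cong: SUP_cong)
qed

end

lemma vnorm_ultrapower:
  fixes x :: "nat \<Rightarrow>\<^sub>C 'a::banach"
  assumes U: "free_ultrafilter U"
  shows "((\<lambda>n. norm (x n)) \<longlongrightarrow> vnorm (ultrapower smul U) (null_class U x)) U"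
proof -
  have bot: "U \<noteq> bot" and ultra: "eventually P U \<or> eventually (\<lambda>n. \<not> P n) U" for P
    using U by (auto simp: free_ultrafilter_def)
  let ?F = "filtermap (\<lambda>n. norm (x n)) U"
  have "compact {0..norm x}" by simp
  moreover have "?F \<noteq> bot" using bot by (simp add: filtermap_bot_iff)
  moreover have "eventually (\<lambda>r. r \<in> {0..norm x}) ?F"
    by (simp add: eventually_filtermap norm_bounded)
  ultimately obtain l where l: "inf (nhds l) ?F \<noteq> bot"
    unfolding compact_filter by blast
  have lim: "((\<lambda>n. norm (x n)) \<longlongrightarrow> l) U"
  proof (rule topological_tendstoI, rule ccontr)
    fix S assume S: "open S" "l \<in> S" "\<not> eventually (\<lambda>n. norm (x n) \<in> S) U"
    then have "eventually (\<lambda>r. r \<notin> S) ?F"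
      using ultra by (auto simp: eventually_filtermap)
    moreover have "eventually (\<lambda>r. r \<in> S) (nhds l)"
      using S by (auto simp: eventually_nhds)
    ultimately have "eventually (\<lambda>r. False) (inf (nhds l) ?F)"
      unfolding eventually_inf by blast
    then show False using l by (simp add: trivial_limit_def)
  qed
  have ge: "l \<le> norm y" if "y \<in> null_class U x" for y
  proof -
    have "((\<lambda>n. norm (y n - x n)) \<longlongrightarrow> 0) U"
      using that by (simp add: null_class_def null_seqs_def)
    from tendsto_diff[OF lim this]
    have "((\<lambda>n. norm (x n) - norm (y n - x n)) \<longlongrightarrow> l) U" by simp
    moreover have "norm (x n) - norm (y n - x n) \<le> norm y" for n
      using norm_bounded[of y n] norm_triangle_ineq2[of "x n" "x n - y n"]
      by (simp add: norm_minus_commute)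
    ultimately show ?thesis
      using bot by (intro tendsto_upperbound[of _ l U]) auto
  qed
  have "(INF y\<in>null_class U x. norm y) = l"
  proof (rule antisym)
    show "l \<le> (INF y\<in>null_class U x. norm y)"
      using ge self_mem_null_class by (intro cINF_greatest) blast+
    show "(INF y\<in>null_class U x. norm y) \<le> l"
    proof (rule field_le_epsilon)
      fix e :: real assume e: "e > 0"
      have l0: "0 \<le> l"
        using lim bot by (intro tendsto_lowerbound[of _ l U 0]) auto
      define g where "g n = (if norm (x n) < l + e then x n else 0)" for n
      have g: "norm (g n) \<le> l + e" for n
        using e l0 by (auto simp: g_def)
      then have "g \<in> bcontfun" by (intro bcontfun_normI) auto
      then obtain y where y: "g = apply_bcontfun y" by (rule bcontfunE)
      have "eventually (\<lambda>n. norm (x n) < l + e) U"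
        using lim e by (intro order_tendstoD) auto
      then have "((\<lambda>n. norm (g n - x n)) \<longlongrightarrow> 0) U"
        by (intro tendsto_eventually) (auto simp: g_def elim: eventually_mono)
      then have "y \<in> null_class U x"
        by (simp add: null_class_def null_seqs_def y)
      moreover have "norm y \<le> l + e"
        using g by (intro norm_bound) (simp add: y)
      ultimately show "(INF y\<in>null_class U x. norm y) \<le> l + e"
        by (intro cINF_lower2[of _ _ y]) (auto intro: bdd_belowI2[of _ 0])
    qed
  qed
  then show ?thesis using lim by (simp add: ultrapower_def)
qed

end

theory Submission
  imports Defs
begin

text \<open>
  Call a midpoint of two points of the unit ball at distance at least \<open>\<alpha>\<close> an \<open>\<alpha>\<close>-midpoint. For a
  Banach space, the slice diameter two property says that for every \<open>\<alpha> < 2\<close> the unit ball is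
  the closed convex hull of the \<open>\<alpha>\<close>-midpoints. Indeed, a point outside the closed convex hull is
  separated from it by a slice that contains no \<open>\<alpha>\<close>-midpoint and therefore, being convex, no pair
  of points at distance at least \<open>\<alpha>\<close>. Conversely, an \<open>\<alpha>\<close>-midpoint deep inside a slice forces both end
  points into the slice, since the functional nowhere exceeds its supremum.

  For the ultrapower this condition becomes quantitative. A convex combination of midpoints in the
  ultrapower has a fixed finite length \<open>m\<close>, and its terms are convex combinations of length \<open>m\<close> in
  the given space. So if points of the unit sphere can be approximated by combinations of a
  length that depends only on the accuracy, the approximations of the terms of a sequence can be
  assembled, by taking limits of the coefficients along the ultrafilter
  (\<open>exists_convex_combination_near\<close>); this gives \<open>slice_D2PI\<close>. If on the other hand there are unit
  vectors \<open>\<xi> n\<close> at distance at least \<open>d\<close> from all combinations of length \<open>n\<close>, then the class of \<open>\<xi>\<close>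
  has distance at least \<open>d\<close> from every combination, of whatever length, in the ultrapower, and the
  Hahn-Banach theorem yields a slice of diameter less than two (\<open>slice_D2P_imp_no_gap\<close>).
  The free ultrafilter for this argument comes from \<open>free_ultrafilter_exists\<close>.

  The Hahn-Banach theorem is obtained from the fact that minimal sublinear functionals are linear
  (\<open>minimal_sublinear_linear\<close>). It is applied to the space of bounded sequences with the seminorm
  that induces the norm of the ultrapower, and \<open>dual_space_extend\<close> turns the resulting real linear
  functional into an element of the dual of the ultrapower over the given scalar field.
\<close>

section \<open>Zorn's lemma and free ultrafilters\<close>

text \<open>
  The form of Zorn's lemma for minimal elements serves both for ultrafilters, which are minimal
  proper filters, and for linear functionals, which are minimal sublinear functionals.
\<close>

lemma zorn_minimal:
  fixes A :: "'b::order set"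
  assumes ne: "A \<noteq> {}"
    and lower: "\<And>C. C \<subseteq> A \<Longrightarrow> C \<noteq> {} \<Longrightarrow> (\<forall>x\<in>C. \<forall>y\<in>C. x \<le> y \<or> y \<le> x) \<Longrightarrow> \<exists>l\<in>A. \<forall>x\<in>C. l \<le> x"
  obtains m where "m \<in> A" "\<And>a. a \<in> A \<Longrightarrow> a \<le> m \<Longrightarrow> a = m"
proof -
  have "\<exists>m\<in>A. \<forall>a\<in>A. (\<ge>) m a \<longrightarrow> a = m"
  proof (rule predicate_Zorn)
    show "partial_order_on A (relation_of (\<ge>) A)"
      by (rule partial_order_on_relation_ofI) auto
  next
    fix C assume C: "C \<in> Chains (relation_of (\<ge>) A)"
    show "\<exists>u\<in>A. \<forall>a\<in>C. a \<ge> u"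
    proof (cases "C = {}")
      case True
      then show ?thesis using ne by blast
    next
      case False
      then show ?thesis
        using C lower[of C] by (force simp: Chains_def relation_of_def)
    qed
  qed
  then show ?thesis using that by blast
qed

text \<open>
  An ultrafilter is a minimal proper filter, and lying below \<^term>\<open>sequentially\<close> makes it free.
  A nonempty chain of proper filters is a filter base, so its infimum is proper.
\<close>

lemma free_ultrafilter_exists: "\<exists>U. free_ultrafilter U"
proof -
  let ?A = "{F. F \<noteq> bot \<and> F \<le> (sequentially :: nat filter)}"
  obtain U where U: "U \<in> ?A" and min: "\<And>F. F \<in> ?A \<Longrightarrow> F \<le> U \<Longrightarrow> F = U"
  proof (rule zorn_minimal[of ?A])
    have "sequentially \<in> ?A" by simp
    then show "?A \<noteq> {}" by blast
  next
    fix C assume C: "C \<subseteq> ?A" "C \<noteq> {}" "\<forall>x\<in>C. \<forall>y\<in>C. x \<le> y \<or> y \<le> x"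
    have "eventually P (Inf C) \<longleftrightarrow> (\<exists>F\<in>C. eventually P F)" for P
    proof (rule eventually_Inf_base[OF C(2)])
      fix F G assume FG: "F \<in> C" "G \<in> C"
      then have "F \<le> G \<or> G \<le> F" using C(3) by blast
      then show "\<exists>x\<in>C. x \<le> inf F G"
        using FG by (metis inf.absorb1 inf.absorb2 order_refl)
    qed
    then have "Inf C \<noteq> bot"
      using C(1) by (auto simp: trivial_limit_def)
    moreover have "Inf C \<le> sequentially"
    proof -
      obtain F where "F \<in> C" using C(2) by blast
      then show ?thesis using C(1) by (intro Inf_lower2[of F]) auto
    qed
    ultimately show "\<exists>l\<in>?A. \<forall>x\<in>C. l \<le> x"
      by (auto intro: Inf_lower)
  qed blast
  have "eventually P U \<or> eventually (\<lambda>n. \<not> P n) U" for P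
  proof (rule disjCI)
    assume "\<not> eventually (\<lambda>n. \<not> P n) U"
    then have "inf U (principal {n. P n}) \<noteq> bot"
      by (simp add: trivial_limit_def eventually_inf_principal)
    \<comment> \<open>A proper filter finer than the minimal filter must be equal to it.\<close>
    then have "inf U (principal {n. P n}) = U"
      using U by (intro min) (auto intro: le_infI1)
    then show "eventually P U"
      by (metis (mono_tags) eventually_inf_principal eventually_mono always_eventually mem_Collect_eq)
  qed
  moreover have "infinite {n. P n}" if "eventually P U" for P
  proof
    assume "finite {n. P n}"
    then have "eventually (\<lambda>n. \<not> P n) sequentially"
      by (simp flip: cofinite_eq_sequentially add: eventually_cofinite)
    then have "eventually (\<lambda>n. \<not> P n) U"
      using U by (auto simp: le_filter_def)
    with that have "eventually (\<lambda>n. False) U"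
      by (rule eventually_elim2) simp
    then show False using U by (simp add: trivial_limit_def)
  qed
  ultimately show ?thesis
    using U by (auto simp: free_ultrafilter_def)
qed

section \<open>Sublinear functionals and the Hahn-Banach theorem\<close>

definition sublinear :: "('v::real_vector \<Rightarrow> real) \<Rightarrow> bool" where
  "sublinear q \<longleftrightarrow> (\<forall>x y. q (x + y) \<le> q x + q y) \<and> (\<forall>t\<ge>0. \<forall>x. q (t *\<^sub>R x) = t * q x)"

lemma sublinear_add: "sublinear q \<Longrightarrow> q (x + y) \<le> q x + q y"
  and sublinear_scale: "sublinear q \<Longrightarrow> t \<ge> 0 \<Longrightarrow> q (t *\<^sub>R x) = t * q x"
  by (auto simp: sublinear_def)

lemma sublinear_0: "sublinear q \<Longrightarrow> q 0 = 0"
  using sublinear_scale[of q 0] by simp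

lemma sublinear_ge_minus: "sublinear q \<Longrightarrow> - q (- x) \<le> q x"
  using sublinear_add[of q x "- x"] sublinear_0[of q] by simp

text \<open>
  Homogeneity needs only one inequality, since the opposite one is the same inequality for the
  factor \<open>1 / t\<close>. Infima of sublinear expressions are easily bounded from above, which makes this
  form convenient.
\<close>

lemma sublinearI:
  assumes "q 0 = 0" and "\<And>x y. q (x + y) \<le> q x + q y"
    and le: "\<And>t x. t > 0 \<Longrightarrow> q (t *\<^sub>R x) \<le> t * q x"
  shows "sublinear q"
proof -
  have "q (t *\<^sub>R x) = t * q x" if "t \<ge> 0" for t x
  proof (cases "t = 0")
    case False
    then have "t > 0" using that by simp
    have "q ((1/t) *\<^sub>R (t *\<^sub>R x)) \<le> (1/t) * q (t *\<^sub>R x)"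
      using \<open>t > 0\<close> by (intro le) simp
    then have "t * q x \<le> q (t *\<^sub>R x)"
      using \<open>t > 0\<close> by (simp add: field_simps)
    then show ?thesis using le[OF \<open>t > 0\<close>, of x] by simp
  qed (simp add: assms(1))
  then show ?thesis using assms by (simp add: sublinear_def)
qed

lemma le_cINF_add:
  fixes F G :: "_ \<Rightarrow> real"
  assumes "A \<noteq> {}" "B \<noteq> {}" and le: "\<And>s t. s \<in> A \<Longrightarrow> t \<in> B \<Longrightarrow> a \<le> F s + G t"
  shows "a \<le> (INF s\<in>A. F s) + (INF t\<in>B. G t)"
proof -
  have "a - F s \<le> (INF t\<in>B. G t)" if "s \<in> A" for s
    using assms(2) le[OF that] by (intro cINF_greatest) (auto simp: algebra_simps)
  then have "a - (INF t\<in>B. G t) \<le> (INF s\<in>A. F s)"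
    using assms(1) by (intro cINF_greatest) (auto simp: algebra_simps)
  then show ?thesis by simp
qed

lemma le_cINF_mult:
  fixes F :: "_ \<Rightarrow> real"
  assumes "A \<noteq> {}" "c > 0" and le: "\<And>s. s \<in> A \<Longrightarrow> a \<le> c * F s"
  shows "a \<le> c * (INF s\<in>A. F s)"
proof -
  have "a / c \<le> (INF s\<in>A. F s)"
    using assms by (intro cINF_greatest) (auto simp: field_simps)
  then show ?thesis using assms(2) by (simp add: field_simps)
qed

text \<open>
  For sublinear \<open>q\<close>, this is the bound that \<open>f \<le> q\<close> and \<open>f y = q y\<close> imply for a linear functional
  \<open>f\<close>, because then \<open>f x = f (x + t *\<^sub>R y) - t * q y \<le> q (x + t *\<^sub>R y) - t * q y\<close> for \<open>t \<ge> 0\<close>.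
\<close>

definition tilt :: "('v::real_vector \<Rightarrow> real) \<Rightarrow> 'v \<Rightarrow> 'v \<Rightarrow> real" where
  "tilt q y x = (INF t\<in>{0..}. q (x + t *\<^sub>R y) - t * q y)"

lemma tilt_le:
  assumes q: "sublinear q" and "t \<ge> 0"
  shows "tilt q y x \<le> q (x + t *\<^sub>R y) - t * q y"
proof -
  have "- q (- x) \<le> q (x + t *\<^sub>R y) - t * q y" if "t \<ge> 0" for t
    using sublinear_add[OF q, of "x + t *\<^sub>R y" "- x"] sublinear_scale[OF q that, of y] by simp
  then have "bdd_below ((\<lambda>t. q (x + t *\<^sub>R y) - t * q y) ` {0..})"
    by (intro bdd_belowI2[of _ "- q (- x)"]) auto
  then show ?thesis
    unfolding tilt_def using assms(2) by (intro cINF_lower) auto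
qed

lemma sublinear_tilt:
  assumes q: "sublinear q"
  shows "sublinear (tilt q y)"
proof (rule sublinearI)
  have "(INF t\<in>{0..}. q (0 + t *\<^sub>R y) - t * q y) = (INF t\<in>{0::real..}. (0::real))"
    by (intro INF_cong) (simp_all add: sublinear_scale[OF q])
  then show "tilt q y 0 = 0"
    by (simp add: tilt_def)
next
  fix x x'
  have "tilt q y (x + x') \<le> (q (x + s *\<^sub>R y) - s * q y) + (q (x' + t *\<^sub>R y) - t * q y)"
    if "s \<ge> 0" "t \<ge> 0" for s t
    using tilt_le[OF q, of "s + t" y "x + x'"] that
      sublinear_add[OF q, of "x + s *\<^sub>R y" "x' + t *\<^sub>R y"]
    by (simp add: algebra_simps)
  then show "tilt q y (x + x') \<le> tilt q y x + tilt q y x'"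
    unfolding tilt_def[of q y x] tilt_def[of q y x'] by (intro le_cINF_add) auto
next
  fix c :: real and x assume c: "c > 0"
  have "tilt q y (c *\<^sub>R x) \<le> c * (q (x + t *\<^sub>R y) - t * q y)" if "t \<ge> 0" for t
    using tilt_le[OF q, of "c * t" y "c *\<^sub>R x"] that c
      sublinear_scale[OF q, of c "x + t *\<^sub>R y"]
    by (simp add: algebra_simps)
  then show "tilt q y (c *\<^sub>R x) \<le> c * tilt q y x"
    unfolding tilt_def[of q y x] using c by (intro le_cINF_mult) auto
qed

text \<open>
  Tilting does not increase a sublinear functional, so a minimal one equals all of its tilts;
  taking \<open>t = 1\<close> in the definition of the tilt turns this into superadditivity.
\<close>

lemma minimal_sublinear_linear:
  assumes q: "sublinear q" and min: "\<And>r. sublinear r \<Longrightarrow> r \<le> q \<Longrightarrow> r = q"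
  shows "linear q"
proof -
  have add: "q (x + y) = q x + q y" for x y
  proof -
    have "tilt q y = q"
      using tilt_le[OF q, of 0 y] by (intro min sublinear_tilt q le_funI) simp
    then have "q x \<le> q (x + y) - q y"
      using tilt_le[OF q, of 1 y x] by simp
    then show ?thesis using sublinear_add[OF q, of x y] by simp
  qed
  have minus: "q (- x) = - q x" for x
    using add[of x "- x"] sublinear_0[OF q] by simp
  have "q (c *\<^sub>R x) = c * q x" for c x
  proof (cases "c \<ge> 0")
    case False
    then show ?thesis
      using sublinear_scale[OF q, of "- c" "- x"] minus[of x] by simp
  qed (simp add: sublinear_scale q)
  then show ?thesis by (intro linearI) (simp_all add: add)
qed

text \<open>
  The pointwise infimum of a chain below \<open>p\<close> is finite because every \<open>q \<le> p\<close> in the chain satisfies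
  \<open>- p (- x) \<le> - q (- x) \<le> q x\<close>. It is subadditive because any two members of the chain lie above
  a common one.
\<close>

lemma minimal_sublinear_exists:
  assumes p: "sublinear (p :: 'v::real_vector \<Rightarrow> real)"
  obtains q where "sublinear q" "q \<le> p" "\<And>r. sublinear r \<Longrightarrow> r \<le> q \<Longrightarrow> r = q"
proof -
  let ?A = "{q. sublinear q \<and> q \<le> p}"
  obtain q where q: "q \<in> ?A" and min: "\<And>r. r \<in> ?A \<Longrightarrow> r \<le> q \<Longrightarrow> r = q"
  proof (rule zorn_minimal[of ?A])
    show "?A \<noteq> {}" using p by auto
  next
    fix C assume C: "C \<subseteq> ?A" "C \<noteq> {}" and chain: "\<forall>q\<in>C. \<forall>r\<in>C. q \<le> r \<or> r \<le> q"
    define l where "l x = (INF q\<in>C. q x)" for x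
    have "- p (- x) \<le> q x" if "q \<in> C" for q x
    proof -
      have "sublinear q" "q (- x) \<le> p (- x)"
        using C(1) that by (auto simp: le_fun_def)
      then show ?thesis using sublinear_ge_minus[of q x] by simp
    qed
    then have l_le: "l x \<le> q x" if "q \<in> C" for q x
      unfolding l_def using that by (intro cINF_lower bdd_belowI2[of _ "- p (- x)"]) auto
    have "sublinear l"
    proof (rule sublinearI)
      have "(INF q\<in>C. q 0) = (INF q\<in>C. (0::real))"
        using C(1) by (intro INF_cong) (auto simp: sublinear_0)
      then show "l 0 = 0" using C(2) by (simp add: l_def)
    next
      fix x y
      have "l (x + y) \<le> q x + r y" if "q \<in> C" "r \<in> C" for q r
      proof -
        obtain s where "s \<in> C" "s \<le> q" "s \<le> r"
          using chain \<open>q \<in> C\<close> \<open>r \<in> C\<close> by auto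
        then have "l (x + y) \<le> s x + s y"
          using l_le[of s "x + y"] C(1) sublinear_add[of s x y] by auto
        also have "\<dots> \<le> q x + r y"
          using \<open>s \<le> q\<close> \<open>s \<le> r\<close> by (intro add_mono) (auto simp: le_fun_def)
        finally show ?thesis .
      qed
      then show "l (x + y) \<le> l x + l y"
        unfolding l_def[of x] l_def[of y] using C(2) by (intro le_cINF_add)
    next
      fix c :: real and x assume "c > 0"
      moreover have "l (c *\<^sub>R x) \<le> c * q x" if "q \<in> C" for q
        using l_le[OF that, of "c *\<^sub>R x"] that C(1) sublinear_scale[of q c x] \<open>c > 0\<close> by auto
      ultimately show "l (c *\<^sub>R x) \<le> c * l x"
        unfolding l_def[of x] using C(2) by (intro le_cINF_mult)
    qed
    moreover have "l \<le> p"
    proof -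
      obtain q where "q \<in> C" using C(2) by blast
      then have "l \<le> q" "q \<le> p" using l_le C(1) by (auto intro: le_funI)
      then show ?thesis by (rule order_trans)
    qed
    ultimately show "\<exists>l\<in>?A. \<forall>q\<in>C. l \<le> q"
      using l_le by (intro bexI[of _ l]) (auto simp: le_fun_def)
  qed blast
  show ?thesis
    using q min by (intro that[of q]) (auto intro: order_trans)
qed

text \<open>
  Any minimal sublinear functional below \<open>p\<close> is linear. Starting from the tilt of \<open>p\<close> at \<open>x\<close>, whose
  value at \<open>- x\<close> is at most \<open>- p x\<close>, forces equality at \<open>x\<close>.
\<close>

lemma hahn_banach:
  assumes p: "sublinear (p :: 'v::real_vector \<Rightarrow> real)"
  shows "\<exists>f. linear f \<and> (\<forall>y. f y \<le> p y) \<and> f x = p x"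
proof -
  obtain f where f: "sublinear f" "f \<le> tilt p x" "\<And>r. sublinear r \<Longrightarrow> r \<le> f \<Longrightarrow> r = f"
    using minimal_sublinear_exists[OF sublinear_tilt[OF p]] by metis
  have lin: "linear f"
    using f by (intro minimal_sublinear_linear) auto
  have le: "f y \<le> p y" for y
    using le_funD[OF f(2), of y] tilt_le[OF p, of 0 x y] by simp
  have "f (- x) \<le> - p x"
    using le_funD[OF f(2), of "- x"] tilt_le[OF p, of 1 x "- x"] sublinear_0[OF p] by simp
  then have "p x \<le> f x" by (simp add: linear_neg[OF lin])
  with le[of x] have "f x = p x" by simp
  with lin le show ?thesis by blast
qed

text \<open>
  The dominating functional is the largest sublinear one that is at most \<open>1\<close> on \<open>C\<close> and at most
  \<open>M * N\<close> everywhere, namely the infimal convolution of the gauge of \<open>C\<close> with \<open>M * N\<close>. The point \<open>x\<close>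
  has value above \<open>1\<close> once \<open>M\<close> is large: reaching \<open>x\<close> from a point \<open>t *\<^sub>R c\<close> either costs
  at least \<open>M * d\<close>, if \<open>t \<le> 1\<close>, or requires \<open>t\<close> itself to exceed \<open>1\<close>.
\<close>

lemma separation_from_convex_set:
  fixes N :: "'v::real_vector \<Rightarrow> real"
  assumes N: "sublinear N" and N_nonneg: "\<And>y. N y \<ge> 0"
    and C: "convex C" "0 \<in> C" and C_bound: "\<And>c. c \<in> C \<Longrightarrow> N c \<le> 1"
    and d: "d > 0" and far: "\<And>c. c \<in> C \<Longrightarrow> N (x - c) \<ge> d"
  obtains f M where "linear f" "\<And>y. f y \<le> M * N y" "\<And>c. c \<in> C \<Longrightarrow> f c \<le> 1" "f x > 1"
proof -
  \<comment> \<open>Then \<open>M * d = 1 + d\<close>, the bound that is also available for \<open>t > 1\<close>;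
    moreover \<open>M \<ge> 1\<close>, so that the term \<open>M * N\<close> compensates a growth of \<open>t\<close>.\<close>
  define M where "M = 1 + 1 / d"
  have M: "M > 0" "M \<ge> 1" and Md: "M * d = 1 + d"
    using d by (auto simp: M_def field_simps add_pos_pos)
  define p where "p v = (INF (t, c)\<in>{0..} \<times> C. t + M * N (v - t *\<^sub>R c))" for v
  have p_le: "p v \<le> t + M * N (v - t *\<^sub>R c)" if "t \<ge> 0" "c \<in> C" for v t c
  proof -
    have "bdd_below ((\<lambda>(t, c). t + M * N (v - t *\<^sub>R c)) ` ({0..} \<times> C))"
      using M N_nonneg by (intro bdd_belowI2[of _ 0]) auto
    then show ?thesis
      unfolding p_def using that cINF_lower[of "\<lambda>(t, c). t + M * N (v - t *\<^sub>R c)" "{0..} \<times> C" "(t, c)"]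
      by auto
  qed
  have ne: "{0::real..} \<times> C \<noteq> {}" using C(2) by auto
  have p_le_N: "p v \<le> M * N v" for v
    using p_le[of 0 0 v] C(2) by simp
  have "sublinear p"
  proof (rule sublinearI)
    have "p 0 \<ge> 0"
      unfolding p_def using ne M N_nonneg by (intro cINF_greatest) auto
    then show "p 0 = 0" using p_le_N[of 0] sublinear_0[OF N] by simp
  next
    fix v w
    have "p (v + w) \<le> (t + M * N (v - t *\<^sub>R c)) + (s + M * N (w - s *\<^sub>R e))"
      if ts: "t \<ge> 0" "s \<ge> 0" and ce: "c \<in> C" "e \<in> C" for t s c e
    proof -
      \<comment> \<open>Convexity: \<open>t\<close> times \<open>C\<close> plus \<open>s\<close> times \<open>C\<close> is contained in \<open>t + s\<close> times \<open>C\<close>.\<close>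
      obtain b where b: "b \<in> C" "(t + s) *\<^sub>R b = t *\<^sub>R c + s *\<^sub>R e"
      proof (cases "t + s = 0")
        case True
        then have "t = 0" "s = 0" using ts by auto
        then show ?thesis using that[of c] ce by simp
      next
        case False
        then have "(t / (t + s)) *\<^sub>R c + (s / (t + s)) *\<^sub>R e \<in> C"
          using ts ce by (intro convexD[OF C(1)]) (auto simp: add_divide_distrib[symmetric])
        moreover have "(t + s) *\<^sub>R ((t / (t + s)) *\<^sub>R c + (s / (t + s)) *\<^sub>R e) = t *\<^sub>R c + s *\<^sub>R e"
          using False by (simp add: scaleR_add_right)
        ultimately show ?thesis by (rule that)
      qed
      have "p (v + w) \<le> (t + s) + M * N (v + w - (t + s) *\<^sub>R b)"
        using ts b by (intro p_le) auto
      also have "v + w - (t + s) *\<^sub>R b = (v - t *\<^sub>R c) + (w - s *\<^sub>R e)"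
        by (simp only: b) simp
      also have "M * N \<dots> \<le> M * (N (v - t *\<^sub>R c) + N (w - s *\<^sub>R e))"
        using M by (intro mult_left_mono sublinear_add[OF N]) auto
      finally show ?thesis by (simp add: algebra_simps)
    qed
    then show "p (v + w) \<le> p v + p w"
      unfolding p_def[of v] p_def[of w] by (intro le_cINF_add ne) auto
  next
    fix a :: real and v assume a: "a > 0"
    have "p (a *\<^sub>R v) \<le> a * (t + M * N (v - t *\<^sub>R c))" if "t \<ge> 0" "c \<in> C" for t c
      using p_le[of "a * t" c "a *\<^sub>R v"] sublinear_scale[OF N, of a "v - t *\<^sub>R c"] a that
      by (simp add: algebra_simps)
    then show "p (a *\<^sub>R v) \<le> a * p v"
      unfolding p_def[of v] using a by (intro le_cINF_mult ne) auto
  qed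
  then obtain f where f: "linear f" "\<And>y. f y \<le> p y" "f x = p x"
    using hahn_banach[of p x] by blast
  have "1 + d \<le> t + M * N (x - t *\<^sub>R c)" if t: "t \<ge> 0" and c: "c \<in> C" for t c
  proof (cases "t \<le> 1")
    case True
    then have "t *\<^sub>R c \<in> C"
      using convexD[OF C(1) c C(2), of t "1 - t"] t by simp
    then have "M * d \<le> M * N (x - t *\<^sub>R c)"
      using M by (intro mult_left_mono far) auto
    then show ?thesis using Md t by simp
  next
    case False
    have "N (x - c) \<le> N (x - t *\<^sub>R c) + N ((t - 1) *\<^sub>R c)"
      using sublinear_add[OF N, of "x - t *\<^sub>R c" "(t - 1) *\<^sub>R c"] by (simp add: algebra_simps)
    also have "N ((t - 1) *\<^sub>R c) \<le> t - 1"
      using False C_bound[OF c] by (simp add: sublinear_scale[OF N] mult_left_le)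
    finally have "1 + d \<le> t + 1 * N (x - t *\<^sub>R c)" using far[OF c] by simp
    also have "\<dots> \<le> t + M * N (x - t *\<^sub>R c)"
      using M N_nonneg by (intro add_left_mono mult_right_mono) auto
    finally show ?thesis .
  qed
  then have "1 + d \<le> p x"
    unfolding p_def using ne by (intro cINF_greatest) auto
  then have "f x > 1" using f(3) d by simp
  moreover have "f c \<le> 1" if "c \<in> C" for c
    using f(2)[of c] p_le[of 1 c c] that sublinear_0[OF N] by simp
  ultimately show ?thesis
    using f(1) by (intro that[of f M]) (auto intro: order_trans f(2) p_le_N)
qed

section \<open>The norm of the ultrapower on bounded sequences\<close>

lemma bounded_sequence_bcontfun:
  fixes g :: "nat \<Rightarrow> 'a::real_normed_vector"
  assumes "\<And>n. norm (g n) \<le> B"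
  shows "\<exists>x :: nat \<Rightarrow>\<^sub>C 'a. norm x \<le> B \<and> (\<forall>n. apply_bcontfun x n = g n)"
proof -
  have "g \<in> bcontfun" using assms by (intro bcontfun_normI) auto
  then obtain x :: "nat \<Rightarrow>\<^sub>C 'a" where x: "g = apply_bcontfun x" by (rule bcontfunE)
  then show ?thesis using assms by (intro exI[of _ x]) (auto intro: norm_bound)
qed

lemma apply_bcontfun_sum:
  fixes x :: "'i \<Rightarrow> ('b::topological_space \<Rightarrow>\<^sub>C 'a::real_normed_vector)"
  shows "(\<Sum>i\<in>I. x i) n = (\<Sum>i\<in>I. x i n)"
  by (induction I rule: infinite_finite_induct) auto

lemma free_ultrafilter_le_sequentially:
  assumes "free_ultrafilter U"
  shows "U \<le> sequentially"
proof (rule filter_leI)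
  fix P :: "nat \<Rightarrow> bool" assume "eventually P sequentially"
  then have "finite {n. \<not> P n}"
    by (simp flip: cofinite_eq_sequentially add: eventually_cofinite)
  then show "eventually P U"
    using assms by (auto simp: free_ultrafilter_def)
qed

text \<open>
  All arguments about the ultrapower take place on bounded sequences, where this seminorm replaces
  the norm of the quotient. This keeps the Hahn-Banach theorem within a type of class
  \<^class>\<open>real_vector\<close>.
\<close>

definition ultranorm :: "nat filter \<Rightarrow> (nat \<Rightarrow>\<^sub>C 'a::banach) \<Rightarrow> real" where
  "ultranorm U x = Lim U (\<lambda>n. norm (x n))"

locale free_ultra =
  fixes U :: "nat filter"
  assumes free: "free_ultrafilter U"
begin

lemma U_ne_bot: "U \<noteq> bot"
  using free by (simp add: free_ultrafilter_def)

lemma vnorm_eq_ultranorm: "vnorm (ultrapower smul U) (null_class U x) = ultranorm U x"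
  using vnorm_ultrapower[OF free, of x smul] U_ne_bot by (simp add: ultranorm_def tendsto_Lim)

lemma tendsto_ultranorm: "((\<lambda>n. norm (x n)) \<longlongrightarrow> ultranorm U x) U"
  for x :: "nat \<Rightarrow>\<^sub>C 'a::banach"
  using vnorm_ultrapower[OF free, of x] by (simp add: vnorm_eq_ultranorm)

lemma ultranorm_eqI: "((\<lambda>n. norm (x n)) \<longlongrightarrow> l) U \<Longrightarrow> ultranorm U x = l"
  for x :: "nat \<Rightarrow>\<^sub>C 'a::banach"
  by (rule tendsto_unique[OF U_ne_bot tendsto_ultranorm])

lemma ultranorm_geI: "eventually (\<lambda>n. a \<le> norm (x n)) U \<Longrightarrow> a \<le> ultranorm U x"
  for x :: "nat \<Rightarrow>\<^sub>C 'a::banach"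
  by (rule tendsto_lowerbound[OF tendsto_ultranorm _ U_ne_bot])

lemma ultranorm_nonneg: "0 \<le> ultranorm U x"
  for x :: "nat \<Rightarrow>\<^sub>C 'a::banach"
  by (rule ultranorm_geI) simp

lemma ultranorm_le_norm: "ultranorm U x \<le> norm x"
  for x :: "nat \<Rightarrow>\<^sub>C 'a::banach"
  by (rule tendsto_upperbound[OF tendsto_ultranorm _ U_ne_bot]) (simp add: norm_bounded)

lemma ultranorm_minus: "ultranorm U (- x) = ultranorm U x"
  for x :: "nat \<Rightarrow>\<^sub>C 'a::banach"
  by (simp add: ultranorm_def)

lemma ultranorm_eq_0_iff: "ultranorm U x = 0 \<longleftrightarrow> x \<in> null_seqs U"
  for x :: "nat \<Rightarrow>\<^sub>C 'a::banach"
  using tendsto_ultranorm[of x] ultranorm_eqI[of x 0] by (auto simp: null_seqs_def)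

lemma sublinear_ultranorm: "sublinear (ultranorm U :: (nat \<Rightarrow>\<^sub>C 'a::banach) \<Rightarrow> real)"
  unfolding sublinear_def
proof (intro conjI allI impI)
  fix x y :: "nat \<Rightarrow>\<^sub>C 'a"
  have "((\<lambda>n. norm (x n) + norm (y n)) \<longlongrightarrow> ultranorm U x + ultranorm U y) U"
    by (intro tendsto_add tendsto_ultranorm)
  then show "ultranorm U (x + y) \<le> ultranorm U x + ultranorm U y"
    using tendsto_ultranorm[of "x + y"]
    by (rule tendsto_le[OF U_ne_bot]) (simp add: norm_triangle_ineq)
next
  fix t :: real and x :: "nat \<Rightarrow>\<^sub>C 'a" assume "t \<ge> 0"
  then show "ultranorm U (t *\<^sub>R x) = t * ultranorm U x"
    by (intro ultranorm_eqI) (auto intro!: tendsto_mult tendsto_ultranorm)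
qed

text \<open>
  A bounded sequence of nonnegative reals is its own sequence of norms, so its limit along \<open>U\<close>
  exists as a value of the seminorm for the Banach space of real numbers.
\<close>

lemma tendsto_bounded_real:
  fixes l :: "nat \<Rightarrow> real"
  assumes "\<And>n. l n \<in> {0..1}"
  shows "\<exists>L\<ge>0. (l \<longlongrightarrow> L) U"
proof -
  have l: "0 \<le> l n" "norm (l n) \<le> 1" for n
    using assms[of n] by auto
  obtain x :: "nat \<Rightarrow>\<^sub>C real" where x: "\<And>n. x n = l n"
    using bounded_sequence_bcontfun[of l, OF l(2)] by blast
  have "(\<lambda>n. norm (x n)) = l"
    by (rule ext) (simp add: x l(1))
  then show ?thesis
    using tendsto_ultranorm[of x] ultranorm_nonneg[of x] by (intro exI[of _ "ultranorm U x"]) auto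
qed

text \<open>
  A representative may exceed norm \<open>1\<close> by a quantity that tends to \<open>0\<close> along \<open>U\<close>. Retracting every
  term radially to the unit ball changes the sequence by exactly this excess, hence stays within
  the same class.
\<close>

lemma unit_ball_ultrapower_iff:
  fixes smul :: "complex \<Rightarrow> 'a::banach \<Rightarrow> 'a"
  shows "A \<in> unit_ball (ultrapower smul U) \<longleftrightarrow> (\<exists>x. norm x \<le> 1 \<and> A = null_class U x)"
proof
  assume A: "A \<in> unit_ball (ultrapower smul U)"
  then obtain w where w: "A = null_class U w" "ultranorm U w \<le> 1"
    by (auto simp: unit_ball_def ultrapower_def simp flip: vnorm_eq_ultranorm[of smul])
  define g where "g n = (1 / max 1 (norm (w n))) *\<^sub>R w n" for n
  have "norm (g n) \<le> 1" for n
    by (simp add: g_def field_simps)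
  then obtain x :: "nat \<Rightarrow>\<^sub>C 'a" where x: "\<And>n. x n = g n" "norm x \<le> 1"
    using bounded_sequence_bcontfun[of g 1] by blast
  have "((\<lambda>n. max 1 (norm (w n)) - 1) \<longlongrightarrow> max 1 (ultranorm U w) - 1) U"
    by (intro tendsto_diff tendsto_max tendsto_const tendsto_ultranorm)
  moreover have "norm ((w - x) n) = max 1 (norm (w n)) - 1" for n
  proof -
    have "(w - x) n = (1 - 1 / max 1 (norm (w n))) *\<^sub>R w n"
      by (simp add: x g_def algebra_simps)
    also have "norm \<dots> = (1 - 1 / max 1 (norm (w n))) * norm (w n)"
      by (simp add: abs_of_nonneg)
    also have "\<dots> = max 1 (norm (w n)) - 1"
      by (simp add: max_def field_simps)
    finally show ?thesis .
  qed
  ultimately have "w - x \<in> null_seqs U"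
    using w(2) by (simp add: null_seqs_def max_def split: if_splits)
  then show "\<exists>x. norm x \<le> 1 \<and> A = null_class U x"
    using x(2) w(1) by (auto simp: null_class_eq_iff)
next
  assume "\<exists>x. norm x \<le> 1 \<and> A = null_class U x"
  then obtain x where x: "norm x \<le> 1" "A = null_class U x" by blast
  then have "A \<in> vectors (ultrapower smul U)" by (simp add: ultrapower_def)
  moreover have "vnorm (ultrapower smul U) A \<le> 1"
    using x ultranorm_le_norm[of x] by (simp add: vnorm_eq_ultranorm)
  ultimately show "A \<in> unit_ball (ultrapower smul U)" by (simp add: unit_ball_def)
qed

end

section \<open>The constants as approximation by convex combinations of bounded length\<close>

lemma conv_nI:
  assumes "\<And>i. i \<in> {1..n} \<Longrightarrow> 0 \<le> l i" "(\<Sum>i=1..n. l i) = 1" "\<And>i. i \<in> {1..n} \<Longrightarrow> x i \<in> C"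
  shows "(\<Sum>i=1..n. l i *\<^sub>R x i) \<in> conv_n n C"
proof -
  have "l i \<le> 1" if "i \<in> {1..n}" for i
    using member_le_sum[of i "{1..n}" l] that assms(1,2) by auto
  then show ?thesis
    using assms unfolding conv_n_def by (intro CollectI exI[of _ l] exI[of _ x]) auto
qed

text \<open>
  Pad with zero coefficients, repeating the first point. A convex combination of length \<open>m\<close> has
  \<open>m \<ge> 1\<close>, since its coefficients sum to \<open>1\<close>.
\<close>

lemma conv_n_mono:
  assumes "m \<le> n"
  shows "conv_n m C \<subseteq> conv_n n C"
proof
  fix z assume "z \<in> conv_n m C"
  then obtain l x where z: "z = (\<Sum>i=1..m. l i *\<^sub>R x i)" and l: "\<And>i. i \<in> {1..m} \<Longrightarrow> 0 \<le> l i"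
    "(\<Sum>i=1..m. l i) = 1" and x: "\<And>i. i \<in> {1..m} \<Longrightarrow> x i \<in> C"
    unfolding conv_n_def by auto
  have "1 \<in> {1..m}" using l(2) by (cases m) auto
  define l' where "l' i = (if i \<in> {1..m} then l i else 0)" for i
  define x' where "x' i = (if i \<in> {1..m} then x i else x 1)" for i
  have sub: "{1..m} \<subseteq> {1..n}" using assms by auto
  have "(\<Sum>i=1..n. l' i) = (\<Sum>i=1..m. l i)"
    using sub by (intro sum.mono_neutral_cong_right) (auto simp: l'_def)
  moreover have "(\<Sum>i=1..n. l' i *\<^sub>R x' i) = z"
    unfolding z using sub by (intro sum.mono_neutral_cong_right) (auto simp: l'_def x'_def)
  moreover have "x' i \<in> C" for i
    using x \<open>1 \<in> {1..m}\<close> by (auto simp: x'_def)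
  moreover have "0 \<le> l' i" for i
    using l(1) by (auto simp: l'_def)
  ultimately show "z \<in> conv_n n C"
    using conv_nI[of n l' x' C] l(2) by simp
qed

lemma subset_conv_n: "n \<ge> 1 \<Longrightarrow> C \<subseteq> conv_n n C"
  using conv_n_mono[of 1 n C] conv_nI[of 1 "\<lambda>_. 1" "\<lambda>_. c" C for c] by auto

context banach_over
begin

lemma unit_vector_exists: "\<exists>e::'a. norm e = 1"
proof -
  obtain x :: 'a where "x \<noteq> 0" using nonzero by blast
  then show ?thesis by (intro exI[of _ "sgn x"]) (simp add: norm_sgn)
qed

text \<open>
  The origin is the midpoint of antipodal unit vectors. It keeps the infima in the constants from
  ranging over the empty set.
\<close>

lemma zero_mem_S_set:
  assumes "\<alpha> \<le> 2"
  shows "0 \<in> (S_set \<alpha> :: 'a set)"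
proof -
  obtain e :: 'a where "norm e = 1" using unit_vector_exists by blast
  moreover have "norm (e - - e) = 2 * norm e"
    by (simp flip: scaleR_2)
  ultimately show ?thesis
    using assms unfolding S_set_def by (intro CollectI exI[of _ e] exI[of _ "- e"]) auto
qed

text \<open>
  The sets of convex combinations increase with \<open>n\<close>, so the constants decrease from \<open>n = 1\<close> on and one
  small constant suffices. The condition on the right has neither suprema nor infima.
\<close>

lemma C_const_tendsto_0_iff:
  assumes "\<alpha> \<le> 2"
  shows "(\<lambda>n. C_const TYPE('a) \<alpha> n) \<longlonglongrightarrow> 0 \<longleftrightarrow>
    (\<forall>\<epsilon>>0. \<exists>n\<ge>1. \<forall>x. norm x = 1 \<longrightarrow> (\<exists>y\<in>conv_n n (S_set \<alpha> :: 'a set). norm (x - y) < \<epsilon>))"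
    (is "?L \<longleftrightarrow> ?R")
proof -
  let ?D = "\<lambda>n x. INF y\<in>conv_n n (S_set \<alpha> :: 'a set). norm (x - y)"
  have zero: "0 \<in> conv_n n (S_set \<alpha> :: 'a set)" if "n \<ge> 1" for n
    using subset_conv_n[OF that] zero_mem_S_set[OF assms] by blast
  have D_le: "?D n x \<le> norm (x - y)" if "y \<in> conv_n n (S_set \<alpha>)" for n x y
    using that by (intro cINF_lower bdd_belowI2[of _ 0]) auto
  have D_nonneg: "?D n x \<ge> 0" if "n \<ge> 1" for n x
    using zero[OF that] by (intro cINF_greatest) auto
  have D_le_1: "?D n x \<le> 1" if "n \<ge> 1" "norm x = 1" for n x
    using D_le[OF zero[OF that(1)], of x] that(2) by simp
  have le_C: "?D n x \<le> C_const TYPE('a) \<alpha> n" if "n \<ge> 1" "norm x = 1" for n x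
    unfolding C_const_def using that
    by (intro cSUP_upper bdd_aboveI2[of _ _ 1] D_le_1) auto
  obtain e :: 'a where e: "norm e = 1" using unit_vector_exists by blast
  show ?thesis
  proof
    assume ?L
    show ?R
    proof (intro allI impI)
      fix \<epsilon> :: real assume "\<epsilon> > 0"
      with \<open>?L\<close> have "eventually (\<lambda>n. C_const TYPE('a) \<alpha> n < \<epsilon>) sequentially"
        by (intro order_tendstoD)
      then have "eventually (\<lambda>n. C_const TYPE('a) \<alpha> n < \<epsilon> \<and> n \<ge> 1) sequentially"
        using eventually_ge_at_top[of "1::nat"] by eventually_elim simp
      then obtain n where n: "C_const TYPE('a) \<alpha> n < \<epsilon>" "n \<ge> 1"
        by (auto simp: eventually_sequentially)
      have "\<exists>y\<in>conv_n n (S_set \<alpha>). norm (x - y) < \<epsilon>" if "norm x = 1" for x :: 'a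
      proof (rule ccontr)
        assume "\<not> ?thesis"
        then have "\<epsilon> \<le> ?D n x"
          using zero[OF n(2)] by (intro cINF_greatest) (auto simp: not_less)
        then show False using le_C[OF n(2) that] n(1) by simp
      qed
      with n(2) show "\<exists>n\<ge>1. \<forall>x. norm x = 1 \<longrightarrow> (\<exists>y\<in>conv_n n (S_set \<alpha> :: 'a set). norm (x - y) < \<epsilon>)"
        by blast
    qed
  next
    assume R: ?R
    show ?L
    proof (rule LIMSEQ_I)
      fix r :: real assume "r > 0"
      then have "r / 2 > 0" by simp
      with R obtain n where n: "n \<ge> 1"
        and near: "\<And>x::'a. norm x = 1 \<Longrightarrow> \<exists>y\<in>conv_n n (S_set \<alpha>). norm (x - y) < r / 2"
        by blast
      have "norm (C_const TYPE('a) \<alpha> k - 0) < r" if k: "k \<ge> n" for k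
      proof -
        have "?D k x \<le> r / 2" if x: "norm x = 1" for x
        proof -
          obtain y where y: "y \<in> conv_n n (S_set \<alpha>)" "norm (x - y) < r / 2"
            using near[OF x] by blast
          then have "y \<in> conv_n k (S_set \<alpha>)" using conv_n_mono[OF k] by blast
          then show ?thesis using D_le[of y k x] y(2) by simp
        qed
        then have "C_const TYPE('a) \<alpha> k \<le> r / 2"
          unfolding C_const_def using e by (intro cSUP_least) (auto simp: set_eq_iff)
        moreover have "0 \<le> C_const TYPE('a) \<alpha> k"
          using le_C[of k e] D_nonneg[of k e] e n k by simp
        ultimately show ?thesis using \<open>r > 0\<close> by simp
      qed
      then show "\<exists>n0. \<forall>n\<ge>n0. norm (C_const TYPE('a) \<alpha> n - 0) < r" by blast
    qed
  qed
qed

end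

section \<open>Functionals on the ultrapower\<close>

locale banach_ultrapower = banach_over K smul + free_ultra U
  for K and smul :: "complex \<Rightarrow> 'a::banach \<Rightarrow> 'a" and U
begin

abbreviation Y where "Y \<equiv> ultrapower smul U"

lemma vectors_Y: "vectors Y = range (null_class U)"
  by (simp add: ultrapower_def)

lemma of_real_mem_K: "of_real r \<in> K"
  using scalars by auto

lemma minus_1_mem_K: "- 1 \<in> K"
  using of_real_mem_K[of "- 1"] by simp

lemma seq_scale_of_real:
  fixes x :: "nat \<Rightarrow>\<^sub>C 'a"
  shows "seq_scale smul (of_real r) x = r *\<^sub>R x"
  by (rule bcontfun_eqI) (simp add: seq_scale_apply of_real_mem_K smul_of_real)

lemma ultranorm_seq_scale:
  fixes x :: "nat \<Rightarrow>\<^sub>C 'a"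
  assumes "c \<in> K"
  shows "ultranorm U (seq_scale smul c x) = cmod c * ultranorm U x"
  by (intro ultranorm_eqI)
    (simp add: seq_scale_apply assms norm_smul tendsto_mult tendsto_ultranorm)

lemma vnorm_diff:
  fixes x y :: "nat \<Rightarrow>\<^sub>C 'a"
  shows "vnorm Y (vadd Y (null_class U x) (vscale Y (- 1) (null_class U y))) = ultranorm U (x - y)"
  using seq_scale_of_real[of "- 1" y]
  by (simp add: vscale_ultrapower minus_1_mem_K vadd_ultrapower vnorm_eq_ultranorm)

lemma unit_ball_ne: "unit_ball Y \<noteq> {}"
proof -
  have "null_class U (0 :: nat \<Rightarrow>\<^sub>C 'a) \<in> unit_ball Y"
    by (auto simp: unit_ball_ultrapower_iff intro!: exI[of _ "0 :: nat \<Rightarrow>\<^sub>C 'a"])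
  then show ?thesis by blast
qed

lemma vnorm_diff_unit_ball_le_2:
  assumes "A \<in> unit_ball Y" "B \<in> unit_ball Y"
  shows "vnorm Y (vadd Y A (vscale Y (- 1) B)) \<le> 2"
proof -
  obtain x y :: "nat \<Rightarrow>\<^sub>C 'a" where "norm x \<le> 1" "norm y \<le> 1" "A = null_class U x" "B = null_class U y"
    using assms by (auto simp: unit_ball_ultrapower_iff)
  moreover have "ultranorm U (x - y) \<le> norm x + norm y"
    using ultranorm_le_norm[of "x - y"] norm_triangle_ineq4[of x y] by simp
  ultimately show ?thesis by (simp add: vnorm_diff)
qed

text \<open>
  A functional on the ultrapower and the real part of its composition with the quotient map carry
  the same information about slices; the latter is a real linear functional on a type.
\<close>

lemma dual_space_pullback:
  assumes "\<phi> \<in> dual_space K Y"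
  shows "linear (\<lambda>x. Re (\<phi> (null_class U x)))"
    and "\<exists>B\<ge>0. \<forall>x. \<bar>Re (\<phi> (null_class U x))\<bar> \<le> B * ultranorm U x"
proof -
  have add: "\<phi> (vadd Y (null_class U x) (null_class U y)) = \<phi> (null_class U x) + \<phi> (null_class U y)"
    and scale: "c \<in> K \<Longrightarrow> \<phi> (vscale Y c (null_class U x)) = c * \<phi> (null_class U x)" for x y c
    using assms by (auto simp: dual_space_def vectors_Y)
  have "\<phi> (null_class U (r *\<^sub>R x)) = of_real r * \<phi> (null_class U x)" for r x
    using scale[OF of_real_mem_K, of r x]
    by (simp add: vscale_ultrapower of_real_mem_K seq_scale_of_real)
  moreover have "\<phi> (null_class U (x + y)) = \<phi> (null_class U x) + \<phi> (null_class U y)" for x y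
    using add[of x y] by (simp add: vadd_ultrapower)
  ultimately show "linear (\<lambda>x. Re (\<phi> (null_class U x)))"
    by (intro linearI) simp_all
  obtain B where B: "cmod (\<phi> (null_class U x)) \<le> B * ultranorm U x" for x
    using assms by (auto simp: dual_space_def vectors_Y vnorm_eq_ultranorm)
  have "\<bar>Re (\<phi> (null_class U x))\<bar> \<le> \<bar>B\<bar> * ultranorm U x" for x
  proof -
    have "\<bar>Re (\<phi> (null_class U x))\<bar> \<le> B * ultranorm U x"
      using abs_Re_le_cmod B by (rule order_trans)
    also have "\<dots> \<le> \<bar>B\<bar> * ultranorm U x"
      by (intro mult_right_mono ultranorm_nonneg) simp
    finally show ?thesis .
  qed
  then show "\<exists>B\<ge>0. \<forall>x. \<bar>Re (\<phi> (null_class U x))\<bar> \<le> B * ultranorm U x"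
    by (intro exI[of _ "\<bar>B\<bar>"]) simp
qed

lemma dual_space_bdd_above:
  assumes "\<phi> \<in> dual_space K Y"
  shows "bdd_above ((\<lambda>A. Re (\<phi> A)) ` unit_ball Y)"
proof -
  obtain B where B: "B \<ge> 0" "\<And>x. \<bar>Re (\<phi> (null_class U x))\<bar> \<le> B * ultranorm U x"
    using dual_space_pullback(2)[OF assms] by blast
  show ?thesis
  proof (rule bdd_aboveI2)
    fix A assume "A \<in> unit_ball Y"
    then obtain x where x: "norm x \<le> 1" "A = null_class U x"
      by (auto simp: unit_ball_ultrapower_iff)
    have "Re (\<phi> A) \<le> B * ultranorm U x"
      using B(2)[of x] by (simp add: x(2))
    also have "\<dots> \<le> B"
      using B(1) x(1) ultranorm_le_norm[of x] by (intro mult_left_le) auto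
    finally show "Re (\<phi> A) \<le> B" .
  qed
qed

text \<open>
  A functional bounded by the seminorm vanishes on null sequences and hence factors through the
  quotient.
\<close>

lemma dual_spaceI_representatives:
  fixes F :: "(nat \<Rightarrow>\<^sub>C 'a) \<Rightarrow> complex"
  assumes K: "\<And>x. F x \<in> K"
    and add: "\<And>x y. F (x + y) = F x + F y"
    and scale: "\<And>c x. c \<in> K \<Longrightarrow> F (seq_scale smul c x) = c * F x"
    and bound: "\<And>x. cmod (F x) \<le> B * ultranorm U x"
  shows "\<exists>\<phi>\<in>dual_space K Y. \<forall>x. \<phi> (null_class U x) = F x"
proof -
  have wd: "F x = F y" if "null_class U x = null_class U y" for x y
  proof -
    have "ultranorm U (x - y) = 0"
      using that by (simp add: ultranorm_eq_0_iff null_class_eq_iff)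
    then have "F (x - y) = 0" using bound[of "x - y"] by simp
    then show ?thesis using add[of "x - y" y] by simp
  qed
  define \<phi> where "\<phi> A = F (SOME x. null_class U x = A)" for A
  have eq: "\<phi> (null_class U x) = F x" for x
    unfolding \<phi>_def by (rule someI2[of _ x]) (auto intro: wd)
  have "\<phi> \<in> dual_space K Y"
    unfolding dual_space_def vectors_Y
    using bound by (auto simp: eq vadd_ultrapower vscale_ultrapower vnorm_eq_ultranorm K add scale)
  then show ?thesis using eq by blast
qed

text \<open>
  Over the complex field, a real linear functional is the real part of
  \<open>x \<mapsto> f x - \<i> * f (\<i> x)\<close>, where \<open>J\<close> in the proof is multiplication by \<open>\<i>\<close>.
\<close>

lemma dual_space_extend:
  fixes f :: "(nat \<Rightarrow>\<^sub>C 'a) \<Rightarrow> real"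
  assumes f: "linear f" and bound: "\<And>x. f x \<le> M * ultranorm U x"
  shows "\<exists>\<phi>\<in>dual_space K Y. \<forall>x. Re (\<phi> (null_class U x)) = f x"
proof -
  have abs_f: "\<bar>f x\<bar> \<le> M * ultranorm U x" for x
    using bound[of x] bound[of "- x"] by (simp add: linear_neg[OF f] ultranorm_minus)
  show ?thesis
  proof (cases "K = \<real>")
    case True
    have "\<exists>\<phi>\<in>dual_space K Y. \<forall>x. \<phi> (null_class U x) = of_real (f x)"
    proof (rule dual_spaceI_representatives)
      fix c :: complex and x assume "c \<in> K"
      then obtain r where "c = of_real r" using True by (auto elim: Reals_cases)
      then show "of_real (f (seq_scale smul c x)) = c * of_real (f x)"
        by (simp add: seq_scale_of_real linear_scale[OF f])
    next
      show "cmod (of_real (f x)) \<le> M * ultranorm U x" for x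
        using abs_f[of x] by simp
    qed (simp_all add: of_real_mem_K linear_add[OF f])
    then show ?thesis by (metis Re_complex_of_real)
  next
    case False
    then have K: "K = UNIV" using scalars by simp
    define J where "J x = seq_scale smul \<i> x" for x :: "nat \<Rightarrow>\<^sub>C 'a"
    have J: "J x n = smul \<i> (x n)" for x n
      by (simp add: J_def seq_scale_apply K)
    have J_add: "J (x + y) = J x + J y" for x y
      by (rule bcontfun_eqI) (simp add: J smul_add_right K)
    have J_J: "J (J x) = - x" for x
      using smul_of_real[of "- 1"] by (intro bcontfun_eqI) (simp add: J smul_smul K)
    have scale_eq: "seq_scale smul c x = Re c *\<^sub>R x + Im c *\<^sub>R J x" for c x
    proof (rule bcontfun_eqI)
      fix n
      have "smul c (x n) = smul (of_real (Re c) + of_real (Im c) * \<i>) (x n)"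
        using complex_eq[of c] by (simp add: mult.commute)
      also have "\<dots> = smul (of_real (Re c)) (x n) + smul (of_real (Im c)) (smul \<i> (x n))"
        by (simp add: smul_add_left smul_smul K)
      finally show "seq_scale smul c x n = (Re c *\<^sub>R x + Im c *\<^sub>R J x) n"
        by (simp add: seq_scale_apply K J smul_of_real)
    qed
    have J_scaleR: "J (r *\<^sub>R x) = r *\<^sub>R J x" for r x
      by (rule bcontfun_eqI) (simp add: J smul_smul K mult.commute flip: smul_of_real)
    define F where "F x = Complex (f x) (- f (J x))" for x
    have "\<exists>\<phi>\<in>dual_space K Y. \<forall>x. \<phi> (null_class U x) = F x"
    proof (rule dual_spaceI_representatives)
      show "F (x + y) = F x + F y" for x y
        by (simp add: F_def J_add linear_add[OF f] complex_eq_iff)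
      show "F (seq_scale smul c x) = c * F x" for c x
        by (simp add: F_def scale_eq J_add J_scaleR J_J linear_add[OF f] linear_scale[OF f]
            linear_neg[OF f] linear_diff[OF f] complex_eq_iff)
      show "cmod (F x) \<le> 2 * M * ultranorm U x" for x
      proof -
        have "ultranorm U (J x) = ultranorm U x"
          by (simp add: J_def ultranorm_seq_scale K)
        then show ?thesis
          using cmod_le[of "F x"] abs_f[of x] abs_f[of "J x"] by (simp add: F_def)
      qed
    qed (simp add: K)
    then show ?thesis by (metis F_def complex.sel(1))
  qed
qed

section \<open>From large slices to uniform approximation\<close>

text \<open>
  An element of the convex hull involves finitely many points, so almost all of its terms are
  convex combinations of one fixed length \<open>k\<close>. As the ultrafilter is free, \<open>k \<le> n\<close> for almost all
  \<open>n\<close>; this is where a sequence of lengths tending to infinity meets a single convex hull in the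
  ultrapower.
\<close>

lemma convex_hull_in_conv_n:
  fixes z :: "nat \<Rightarrow>\<^sub>C 'a"
  assumes z: "z \<in> convex hull S" and S: "\<And>w. w \<in> S \<Longrightarrow> eventually (\<lambda>n. w n \<in> T) U"
  shows "eventually (\<lambda>n. z n \<in> conv_n n T) U"
proof -
  obtain k :: nat and l w where lw: "\<forall>i\<in>{1..k}. 0 \<le> l i \<and> w i \<in> S" "sum l {1..k} = 1"
    and z_eq: "(\<Sum>i=1..k. l i *\<^sub>R w i) = z"
    using z unfolding convex_hull_indexed mem_Collect_eq by (elim exE conjE) (rule that)
  have "eventually (\<lambda>n. \<forall>i\<in>{1..k}. w i n \<in> T) U"
    using lw(1) S by (intro eventually_ball_finite) auto
  moreover have "eventually (\<lambda>n. k \<le> n) U"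
    using free_ultrafilter_le_sequentially[OF free] eventually_ge_at_top[of k]
    by (simp add: le_filter_def)
  ultimately show ?thesis
  proof eventually_elim
    case (elim n)
    have "(\<Sum>i=1..k. l i *\<^sub>R w i n) \<in> conv_n k T"
      using lw elim by (intro conv_nI) auto
    moreover have "z n = (\<Sum>i=1..k. l i *\<^sub>R w i n)"
      by (simp add: apply_bcontfun_sum flip: z_eq)
    ultimately show ?case using conv_n_mono[OF elim(2)] by auto
  qed
qed

text \<open>
  If for every \<open>n\<close> some unit vector \<open>\<xi> n\<close> has distance at least \<open>d\<close> from the convex combinations of
  length \<open>n\<close>, then the class of \<open>\<xi>\<close> has distance at least \<open>d\<close> from the convex hull of
  all midpoints \<open>(u + v) / 2\<close> with \<open>u\<close> and \<open>v\<close> in the unit ball of the ultrapower at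
  distance greater than \<open>\<alpha>\<close>. A separating functional is at most \<open>1\<close> on this hull and
  greater than \<open>1\<close> at the class of \<open>\<xi>\<close>, so it cuts off a slice, which is convex and avoids all such
  midpoints. Hence no two points of the slice are further apart than \<open>\<alpha>\<close>.
\<close>

lemma slice_D2P_imp_no_gap:
  assumes D2P: "slice_D2P K Y" and \<alpha>: "\<alpha> < 2" and d: "d > 0"
  shows "\<exists>n\<ge>1. \<forall>x::'a. norm x = 1 \<longrightarrow> (\<exists>y\<in>conv_n n (S_set \<alpha>). norm (x - y) < d)"
proof (rule ccontr)
  assume "\<not> ?thesis"
  then have "\<forall>n. \<exists>x::'a. norm x = 1 \<and> (n \<ge> 1 \<longrightarrow> (\<forall>y\<in>conv_n n (S_set \<alpha>). d \<le> norm (x - y)))"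
    using unit_vector_exists by (metis not_less)
  then obtain \<xi> :: "nat \<Rightarrow> 'a" where \<xi>: "\<And>n. norm (\<xi> n) = 1"
    and \<xi>_far: "\<And>n y. n \<ge> 1 \<Longrightarrow> y \<in> conv_n n (S_set \<alpha>) \<Longrightarrow> d \<le> norm (\<xi> n - y)"
    by metis
  obtain x :: "nat \<Rightarrow>\<^sub>C 'a" where x: "\<And>n. x n = \<xi> n" "norm x \<le> 1"
    using bounded_sequence_bcontfun[of \<xi> 1] \<xi> by auto
  \<comment> \<open>The strict inequality for the limit gives \<open>\<alpha> < norm (u n - v n)\<close> for almost all \<open>n\<close>;
    a weak one would not give \<open>\<alpha> \<le> norm (u n - v n)\<close>.\<close>
  define S where "S = {(1/2) *\<^sub>R (u + v) | u v :: nat \<Rightarrow>\<^sub>C 'a.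
    norm u \<le> 1 \<and> norm v \<le> 1 \<and> \<alpha> < ultranorm U (u - v)}"
  have far: "d \<le> ultranorm U (x - c)" if c: "c \<in> convex hull S" for c
  proof -
    have "eventually (\<lambda>n. c n \<in> conv_n n (S_set \<alpha>)) U"
    proof (rule convex_hull_in_conv_n[OF c])
      fix w assume "w \<in> S"
      then obtain u v where w: "w = (1/2) *\<^sub>R (u + v)" and uv: "norm u \<le> 1" "norm v \<le> 1"
        "\<alpha> < ultranorm U (u - v)"
        by (auto simp: S_def)
      have le: "norm (u n) \<le> 1" "norm (v n) \<le> 1" for n
        using norm_bounded[of u n] norm_bounded[of v n] uv by linarith+
      have "eventually (\<lambda>n. \<alpha> < norm ((u - v) n)) U"
        using tendsto_ultranorm uv(3) by (rule order_tendstoD)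
      then show "eventually (\<lambda>n. w n \<in> S_set \<alpha>) U"
      proof eventually_elim
        case (elim n)
        then show ?case
          unfolding w S_set_def using le[of n]
          by (intro CollectI exI[of _ "u n"] exI[of _ "v n"]) auto
      qed
    qed
    moreover have "eventually (\<lambda>n. 1 \<le> n) U"
      using free_ultrafilter_le_sequentially[OF free] eventually_ge_at_top[of "1::nat"]
      by (simp add: le_filter_def)
    ultimately have "eventually (\<lambda>n. d \<le> norm ((x - c) n)) U"
      by eventually_elim (simp add: x \<xi>_far)
    then show ?thesis by (rule ultranorm_geI)
  qed
  have zero: "0 \<in> convex hull S"
  proof -
    obtain e :: 'a where e: "norm e = 1" using unit_vector_exists by blast
    obtain u :: "nat \<Rightarrow>\<^sub>C 'a" where u: "\<And>n. u n = e" "norm u \<le> 1"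
      using bounded_sequence_bcontfun[of "\<lambda>_. e" 1] e by auto
    have "norm (e + e) = 2"
      using e by (simp flip: scaleR_2)
    then have "ultranorm U (u - - u) = 2"
      by (intro ultranorm_eqI) (simp add: u)
    then have "0 \<in> S"
      unfolding S_def using u(2) \<alpha> by (intro CollectI exI[of _ u] exI[of _ "- u"]) auto
    then show ?thesis by (rule hull_inc)
  qed
  have "S \<subseteq> cball 0 1"
  proof
    fix w assume "w \<in> S"
    then obtain u v where "w = (1/2) *\<^sub>R (u + v)" "norm u \<le> 1" "norm v \<le> 1"
      by (auto simp: S_def)
    then show "w \<in> cball 0 1"
      using norm_triangle_ineq[of u v] by simp
  qed
  then have "convex hull S \<subseteq> cball 0 1"
    by (intro hull_minimal) auto
  then have bound: "ultranorm U c \<le> 1" if "c \<in> convex hull S" for c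
    using that ultranorm_le_norm[of c] by auto
  obtain f M where f: "linear f" "\<And>y. f y \<le> M * ultranorm U y"
    and f_S: "\<And>c. c \<in> convex hull S \<Longrightarrow> f c \<le> 1" and f_x: "f x > 1"
    using separation_from_convex_set[OF sublinear_ultranorm ultranorm_nonneg convex_convex_hull
        zero bound d far] by blast
  obtain \<phi> where \<phi>: "\<phi> \<in> dual_space K Y" "\<And>y. Re (\<phi> (null_class U y)) = f y"
    using dual_space_extend[OF f] by blast
  define s where "s = (SUP A\<in>unit_ball Y. Re (\<phi> A))"
  have x_ball: "null_class U x \<in> unit_ball Y"
    using x(2) by (auto simp: unit_ball_ultrapower_iff)
  have "Re (\<phi> (null_class U x)) \<le> s"
    unfolding s_def using x_ball dual_space_bdd_above[OF \<phi>(1)] by (rule cSUP_upper)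
  then have "f x \<le> s" by (simp add: \<phi>(2))
  \<comment> \<open>The slice on which the separating functional exceeds its bound on the hull.\<close>
  define T where "T = slice Y \<phi> (s - 1)"
  have T: "T = {A \<in> unit_ball Y. Re (\<phi> A) > 1}"
    by (simp add: T_def slice_def s_def)
  have "null_class U x \<in> T"
    using x_ball f_x by (simp add: T \<phi>(2))
  have "vdiameter Y T = 2"
    using D2P \<phi>(1) f_x \<open>f x \<le> s\<close> unfolding slice_D2P_def T_def by simp
  moreover have "\<alpha> < vdiameter Y T \<Longrightarrow> \<exists>A\<in>T. \<exists>B\<in>T. \<alpha> < vnorm Y (vadd Y A (vscale Y (- 1) B))"
  proof (rule ccontr)
    assume "\<not> (\<exists>A\<in>T. \<exists>B\<in>T. \<alpha> < vnorm Y (vadd Y A (vscale Y (- 1) B)))"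
    then have "vdiameter Y T \<le> \<alpha>"
      unfolding vdiameter_def using \<open>null_class U x \<in> T\<close>
      by (intro cSUP_least) (auto simp: not_less)
    moreover assume "\<alpha> < vdiameter Y T"
    ultimately show False by simp
  qed
  ultimately obtain A B where AB: "A \<in> T" "B \<in> T" "\<alpha> < vnorm Y (vadd Y A (vscale Y (- 1) B))"
    using \<alpha> by auto
  then obtain u v where u: "A = null_class U u" "norm u \<le> 1" and v: "B = null_class U v" "norm v \<le> 1"
    by (auto simp: T unit_ball_ultrapower_iff)
  have "(1/2) *\<^sub>R (u + v) \<in> S"
    using AB(3) u v by (auto simp: S_def vnorm_diff)
  then have "f ((1/2) *\<^sub>R (u + v)) \<le> 1"
    by (intro f_S hull_inc)
  moreover have "f u > 1" "f v > 1"
    using AB u v by (auto simp: T \<phi>(2))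
  ultimately show False
    by (simp add: linear_scale[OF f(1)] linear_add[OF f(1)])
qed

section \<open>From uniform approximation to large slices\<close>

text \<open>
  The uniform approximation concerns unit vectors, so a point \<open>w\<close> of the ball is replaced by
  a sequence \<open>x\<close> of unit vectors. With \<open>r\<close> the norm of the class of \<open>w\<close>, normalizing the terms of
  \<open>w\<close> gives an \<open>x\<close> such that \<open>w\<close> and \<open>r *\<^sub>R x\<close> have the same class. As \<open>0 \<le> r \<le> 1\<close>, one of
  \<open>x\<close> and \<open>- x\<close> has a value under \<open>g\<close> that is at least \<open>g w\<close>.
\<close>

lemma exists_normalized_sequence:
  fixes w :: "nat \<Rightarrow>\<^sub>C 'a"
  assumes g: "linear g" and bound: "\<And>x. \<bar>g x\<bar> \<le> B * ultranorm U x" and w: "norm w \<le> 1"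
  shows "\<exists>x. (\<forall>n. norm (apply_bcontfun x n) = 1) \<and> g w \<le> g x"
proof -
  obtain e :: 'a where e: "norm e = 1" using unit_vector_exists by blast
  define h where "h n = (if w n = 0 then e else (1 / norm (w n)) *\<^sub>R w n)" for n
  have h: "norm (h n) = 1" for n by (simp add: h_def e)
  obtain x :: "nat \<Rightarrow>\<^sub>C 'a" where x: "\<And>n. x n = h n"
    using bounded_sequence_bcontfun[of h 1] h by auto
  define r where "r = ultranorm U w"
  have r: "0 \<le> r" "r \<le> 1"
    using ultranorm_nonneg[of w] ultranorm_le_norm[of w] w by (auto simp: r_def)
  have "((\<lambda>n. \<bar>norm (w n) - r\<bar>) \<longlongrightarrow> \<bar>r - r\<bar>) U"
    unfolding r_def by (intro tendsto_rabs tendsto_diff tendsto_ultranorm tendsto_const)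
  moreover have "norm ((w - r *\<^sub>R x) n) = \<bar>norm (w n) - r\<bar>" for n
  proof -
    have "w n = norm (w n) *\<^sub>R h n" by (simp add: h_def)
    then have "(w - r *\<^sub>R x) n = (norm (w n) - r) *\<^sub>R h n"
      by (simp add: x algebra_simps)
    then show ?thesis by (simp add: h)
  qed
  ultimately have "ultranorm U (w - r *\<^sub>R x) = 0"
    by (intro ultranorm_eqI) simp
  then have "g w = r * g x"
    using bound[of "w - r *\<^sub>R x"] by (simp add: linear_diff[OF g] linear_scale[OF g])
  also have "\<dots> \<le> \<bar>r * g x\<bar>" by simp
  also have "\<dots> \<le> \<bar>g x\<bar>"
    using r by (simp add: abs_mult mult_left_le_one_le)
  finally have "g w \<le> g x \<or> g w \<le> g (- x)"
    by (auto simp: linear_neg[OF g] abs_if split: if_splits)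
  then show ?thesis
  proof
    assume "g w \<le> g x"
    then show ?thesis by (intro exI[of _ x]) (simp add: x h)
  next
    assume "g w \<le> g (- x)"
    then show ?thesis by (intro exI[of _ "- x"]) (simp add: x h)
  qed
qed

text \<open>
  Because the length \<open>m\<close> does not depend on \<open>n\<close>, the combinations chosen for the individual terms can
  be assembled: the coefficients converge along \<open>U\<close>, and the points form \<open>m\<close> pairs of sequences in
  the unit ball. Replacing the coefficients by their limits costs an error that tends to \<open>0\<close>
  along \<open>U\<close>.
\<close>

lemma exists_convex_combination_near:
  fixes x :: "nat \<Rightarrow>\<^sub>C 'a"
  assumes near: "\<And>n. \<exists>y\<in>conv_n m (S_set \<alpha>). norm (x n - y) < \<epsilon>"
  shows "\<exists>L u v. (\<forall>i\<in>{1..m}. 0 \<le> L i \<and> norm (u i) \<le> 1 \<and> norm (v i) \<le> 1 \<and> \<alpha> \<le> ultranorm U (u i - v i))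
    \<and> sum L {1..m} = 1 \<and> ultranorm U (x - (\<Sum>i=1..m. L i *\<^sub>R ((1/2) *\<^sub>R (u i + v i)))) \<le> \<epsilon>"
proof -
  define good where "good n l p q \<longleftrightarrow>
    (\<forall>i\<in>{1..m}. l i \<in> {0..1} \<and> norm (p i) \<le> 1 \<and> norm (q i) \<le> 1 \<and> \<alpha> \<le> norm (p i - q i)) \<and>
    sum l {1..m} = 1 \<and> norm (x n - (\<Sum>i=1..m. l i *\<^sub>R ((1/2) *\<^sub>R (p i + q i)))) < \<epsilon>"
    for n and l :: "nat \<Rightarrow> real" and p q
  have "\<exists>l p q. good n l p q" for n
  proof -
    obtain y where y: "y \<in> conv_n m (S_set \<alpha>)" "norm (x n - y) < \<epsilon>" using near by blast
    then obtain l z where l: "\<forall>i\<in>{1..m}. l i \<in> {0..1::real}" "sum l {1..m} = 1"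
      and z: "\<forall>i\<in>{1..m}. z i \<in> S_set \<alpha>" and y_eq: "y = (\<Sum>i=1..m. l i *\<^sub>R z i)"
      unfolding conv_n_def by blast
    have "\<forall>i\<in>{1..m}. \<exists>p q. z i = (1/2) *\<^sub>R (p + q) \<and> norm p \<le> 1 \<and> norm q \<le> 1 \<and> \<alpha> \<le> norm (p - q)"
      using z by (simp add: S_set_def Bex_def)
    then obtain p q where pq: "\<forall>i\<in>{1..m}. z i = (1/2) *\<^sub>R (p i + q i) \<and> norm (p i) \<le> 1 \<and> norm (q i) \<le> 1 \<and>
      \<alpha> \<le> norm (p i - q i)"
      by metis
    have "y = (\<Sum>i=1..m. l i *\<^sub>R ((1/2) *\<^sub>R (p i + q i)))"
      unfolding y_eq using pq by (intro sum.cong) auto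
    then have "good n l p q"
      using l pq y(2) by (auto simp: good_def)
    then show ?thesis by blast
  qed
  then obtain l p q where good: "\<And>n. good n (l n) (p n) (q n)"
    by metis
  have lpq: "l n i \<in> {0..1} \<and> norm (p n i) \<le> 1 \<and> norm (q n i) \<le> 1 \<and> \<alpha> \<le> norm (p n i - q n i)"
    if "i \<in> {1..m}" for n i
    using good[of n] that unfolding good_def by blast
  have sum_l: "sum (l n) {1..m} = 1"
    and close: "norm (x n - (\<Sum>i=1..m. l n i *\<^sub>R ((1/2) *\<^sub>R (p n i + q n i)))) < \<epsilon>" for n
    using good[of n] by (auto simp: good_def)
  have "\<forall>i\<in>{1..m}. \<exists>t\<ge>0. ((\<lambda>n. l n i) \<longlongrightarrow> t) U"
    using lpq by (intro ballI tendsto_bounded_real) blast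
  then obtain L where L: "\<And>i. i \<in> {1..m} \<Longrightarrow> ((\<lambda>n. l n i) \<longlongrightarrow> L i) U" "\<And>i. i \<in> {1..m} \<Longrightarrow> 0 \<le> L i"
    by metis
  have "\<forall>i\<in>{1..m}. \<exists>u :: nat \<Rightarrow>\<^sub>C 'a. norm u \<le> 1 \<and> (\<forall>n. apply_bcontfun u n = p n i)"
    using lpq by (intro ballI bounded_sequence_bcontfun) auto
  then obtain u :: "nat \<Rightarrow> nat \<Rightarrow>\<^sub>C 'a"
    where u: "\<And>i. i \<in> {1..m} \<Longrightarrow> norm (u i) \<le> 1" "\<And>i n. i \<in> {1..m} \<Longrightarrow> u i n = p n i"
    by metis
  have "\<forall>i\<in>{1..m}. \<exists>v :: nat \<Rightarrow>\<^sub>C 'a. norm v \<le> 1 \<and> (\<forall>n. apply_bcontfun v n = q n i)"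
    using lpq by (intro ballI bounded_sequence_bcontfun) auto
  then obtain v :: "nat \<Rightarrow> nat \<Rightarrow>\<^sub>C 'a"
    where v: "\<And>i. i \<in> {1..m} \<Longrightarrow> norm (v i) \<le> 1" "\<And>i n. i \<in> {1..m} \<Longrightarrow> v i n = q n i"
    by metis
  have "((\<lambda>n. sum (l n) {1..m}) \<longlongrightarrow> sum L {1..m}) U"
    using L(1) by (intro tendsto_sum)
  then have sum_L: "sum L {1..m} = 1"
    unfolding sum_l by (rule tendsto_unique[OF U_ne_bot _ tendsto_const])
  have far: "\<alpha> \<le> ultranorm U (u i - v i)" if "i \<in> {1..m}" for i
    using lpq[OF that] u(2)[OF that] v(2)[OF that] by (intro ultranorm_geI) simp
  define z where "z = (\<Sum>i=1..m. L i *\<^sub>R ((1/2) *\<^sub>R (u i + v i)))"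
  have "norm ((x - z) n) \<le> \<epsilon> + (\<Sum>i=1..m. \<bar>l n i - L i\<bar>)" for n
  proof -
    define a where "a i = (1/2) *\<^sub>R (p n i + q n i)" for i
    have a: "norm (a i) \<le> 1" if "i \<in> {1..m}" for i
      using lpq[OF that, of n] norm_triangle_ineq[of "p n i" "q n i"] by (simp add: a_def)
    have "z n = (\<Sum>i=1..m. L i *\<^sub>R a i)"
      unfolding z_def apply_bcontfun_sum by (intro sum.cong) (simp_all add: a_def u v)
    then have "(x - z) n = (x n - (\<Sum>i=1..m. l n i *\<^sub>R a i)) + (\<Sum>i=1..m. (l n i - L i) *\<^sub>R a i)"
      by (simp add: scaleR_left_diff_distrib sum_subtractf)
    also have "norm \<dots> \<le> norm (x n - (\<Sum>i=1..m. l n i *\<^sub>R a i)) + norm (\<Sum>i=1..m. (l n i - L i) *\<^sub>R a i)"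
      by (rule norm_triangle_ineq)
    also have "norm (\<Sum>i=1..m. (l n i - L i) *\<^sub>R a i) \<le> (\<Sum>i=1..m. \<bar>l n i - L i\<bar>)"
      using a by (intro sum_norm_le) (auto intro: mult_left_le)
    also have "norm (x n - (\<Sum>i=1..m. l n i *\<^sub>R a i)) \<le> \<epsilon>"
      using close[of n] by (simp add: a_def)
    finally show ?thesis by simp
  qed
  moreover have "((\<lambda>n. \<epsilon> + (\<Sum>i=1..m. \<bar>l n i - L i\<bar>)) \<longlongrightarrow> \<epsilon> + (\<Sum>i=1..m. \<bar>L i - L i\<bar>)) U"
    using L(1) by (intro tendsto_intros)
  ultimately have "ultranorm U (x - z) \<le> \<epsilon> + (\<Sum>i=1..m. \<bar>L i - L i\<bar>)"
    using tendsto_ultranorm[of "x - z"] by (intro tendsto_le[OF U_ne_bot]) auto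
  then have "ultranorm U (x - z) \<le> \<epsilon>" by simp
  then show ?thesis
    using L(2) u(1) v(1) far sum_L unfolding z_def
    by (intro exI[of _ L] exI[of _ u] exI[of _ v]) auto
qed

text \<open>
  A convex combination on which \<open>g\<close> is nearly \<open>g w\<close> must involve a midpoint with this property.
\<close>

lemma exists_far_pair_near_supremum:
  fixes w :: "nat \<Rightarrow>\<^sub>C 'a"
  assumes lim: "\<And>\<epsilon>. \<epsilon> > 0 \<Longrightarrow> \<exists>n\<ge>1. \<forall>x::'a. norm x = 1 \<longrightarrow> (\<exists>y\<in>conv_n n (S_set \<alpha>). norm (x - y) < \<epsilon>)"
    and g: "linear g" and B: "B \<ge> 0" "\<And>x. \<bar>g x\<bar> \<le> B * ultranorm U x"
    and w: "norm w \<le> 1" and e: "e > 0"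
  shows "\<exists>u v. norm u \<le> 1 \<and> norm v \<le> 1 \<and> \<alpha> \<le> ultranorm U (u - v) \<and> 2 * (g w - e) < g u + g v"
proof -
  obtain x where x: "\<And>n. norm (apply_bcontfun x n) = 1" "g w \<le> g x"
    using exists_normalized_sequence[OF g B(2) w] by blast
  \<comment> \<open>The summand \<open>1\<close> makes the quotient meaningful when \<open>B = 0\<close>.\<close>
  define \<epsilon> where "\<epsilon> = e / (B + 1)"
  have \<epsilon>: "\<epsilon> > 0" "B * \<epsilon> < e"
    using B(1) e by (auto simp: \<epsilon>_def field_simps add_pos_nonneg)
  obtain m where m: "\<And>x::'a. norm x = 1 \<Longrightarrow> \<exists>y\<in>conv_n m (S_set \<alpha>). norm (x - y) < \<epsilon>"
    using lim[OF \<epsilon>(1)] by blast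
  obtain L u v where uv: "\<And>i. i \<in> {1..m} \<Longrightarrow> 0 \<le> L i \<and> norm (u i) \<le> 1 \<and> norm (v i) \<le> 1 \<and>
      \<alpha> \<le> ultranorm U (u i - v i)"
    and sum_L: "sum L {1..m} = 1"
    and close: "ultranorm U (x - (\<Sum>i=1..m. L i *\<^sub>R ((1/2) *\<^sub>R (u i + v i)))) \<le> \<epsilon>"
    using exists_convex_combination_near[of m \<alpha> x \<epsilon>] m x(1) by blast
  define z where "z i = (1/2) *\<^sub>R (u i + v i)" for i
  have gz: "g (z i) = (g (u i) + g (v i)) / 2" for i
    by (simp add: z_def linear_scale[OF g] linear_add[OF g])
  have "g x - g (\<Sum>i=1..m. L i *\<^sub>R z i) \<le> B * ultranorm U (x - (\<Sum>i=1..m. L i *\<^sub>R z i))"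
    using B(2)[of "x - (\<Sum>i=1..m. L i *\<^sub>R z i)"] by (simp add: linear_diff[OF g])
  also have "\<dots> \<le> B * \<epsilon>"
    using close B(1) by (intro mult_left_mono) (simp_all add: z_def)
  finally have "g w - e < g (\<Sum>i=1..m. L i *\<^sub>R z i)"
    using \<epsilon>(2) x(2) by linarith
  also have "\<dots> = (\<Sum>i=1..m. L i * g (z i))"
    by (simp add: linear_sum[OF g] linear_scale[OF g])
  finally have gt: "g w - e < (\<Sum>i=1..m. L i * g (z i))" .
  have "\<exists>i\<in>{1..m}. g w - e < g (z i)"
  proof (rule ccontr)
    assume "\<not> ?thesis"
    then have "(\<Sum>i=1..m. L i * g (z i)) \<le> (\<Sum>i=1..m. L i * (g w - e))"
      using uv by (intro sum_mono mult_left_mono) (auto simp: not_less)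
    also have "\<dots> = g w - e"
      using sum_L by (simp flip: sum_distrib_right)
    finally show False using gt by simp
  qed
  then obtain i where i: "i \<in> {1..m}" "g w - e < g (z i)" by blast
  then show ?thesis
    using uv[OF i(1)] gz[of i] by (intro exI[of _ "u i"] exI[of _ "v i"]) auto
qed

text \<open>
  If the mean of \<open>g u\<close> and \<open>g v\<close> is within \<open>\<beta> / 2\<close> of the supremum \<open>s\<close>, then both values are within
  \<open>\<beta>\<close> of \<open>s\<close>, as neither exceeds \<open>s\<close>. So both end points of a far pair with midpoint near the
  supremum lie in the slice.
\<close>

lemma slice_D2PI:
  assumes lim: "\<And>\<alpha> \<epsilon>. 0 < \<alpha> \<Longrightarrow> \<alpha> < 2 \<Longrightarrow> \<epsilon> > 0 \<Longrightarrow>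
    \<exists>n\<ge>1. \<forall>x::'a. norm x = 1 \<longrightarrow> (\<exists>y\<in>conv_n n (S_set \<alpha>). norm (x - y) < \<epsilon>)"
  shows "slice_D2P K Y"
  unfolding slice_D2P_def
proof (intro ballI allI impI)
  fix \<phi> and \<beta> :: real assume \<phi>: "\<phi> \<in> dual_space K Y" and \<beta>: "\<beta> > 0"
  define g where "g x = Re (\<phi> (null_class U x))" for x
  have g: "linear g" using dual_space_pullback(1)[OF \<phi>] by (simp add: g_def[abs_def])
  obtain B where B: "B \<ge> 0" "\<And>x. \<bar>g x\<bar> \<le> B * ultranorm U x"
    using dual_space_pullback(2)[OF \<phi>] by (auto simp: g_def)
  define s where "s = (SUP A\<in>unit_ball Y. Re (\<phi> A))"
  have g_le_s: "g x \<le> s" if "norm x \<le> 1" for x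
  proof -
    have "null_class U x \<in> unit_ball Y"
      using that by (auto simp: unit_ball_ultrapower_iff)
    then show ?thesis
      unfolding s_def g_def using dual_space_bdd_above[OF \<phi>] by (rule cSUP_upper)
  qed
  \<comment> \<open>One quarter for the choice of \<open>w\<close> and one for the loss in passing to a midpoint.\<close>
  have "\<exists>w. norm w \<le> 1 \<and> s - \<beta> / 4 < g w"
  proof (rule ccontr)
    assume "\<not> ?thesis"
    then have "Re (\<phi> A) \<le> s - \<beta> / 4" if "A \<in> unit_ball Y" for A
      using that by (auto simp: unit_ball_ultrapower_iff g_def not_less)
    then have "(SUP A\<in>unit_ball Y. Re (\<phi> A)) \<le> s - \<beta> / 4"
      by (intro cSUP_least unit_ball_ne)
    then show False using \<beta> by (simp add: s_def)
  qed
  then obtain w where w: "norm w \<le> 1" "s - \<beta> / 4 < g w" by blast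
  define T where "T = slice Y \<phi> \<beta>"
  have T_I: "null_class U x \<in> T" if "norm x \<le> 1" "s - \<beta> < g x" for x
    using that by (auto simp: T_def slice_def unit_ball_ultrapower_iff s_def g_def)
  let ?d = "\<lambda>(A, B). vnorm Y (vadd Y A (vscale Y (- 1) B))"
  have d_le: "?d AB \<le> 2" if "AB \<in> T \<times> T" for AB
    using that vnorm_diff_unit_ball_le_2 by (auto simp: T_def slice_def)
  have "vdiameter Y T = 2"
  proof (rule antisym)
    have "T \<noteq> {}" using T_I[OF w(1)] w(2) \<beta> by auto
    then show "vdiameter Y T \<le> 2"
      unfolding vdiameter_def using d_le by (intro cSUP_least) auto
    show "2 \<le> vdiameter Y T"
    proof (rule dense_le_bounded[of 0])
      fix \<alpha> :: real assume \<alpha>: "0 < \<alpha>" "\<alpha> < 2"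
      obtain u v where uv: "norm u \<le> 1" "norm v \<le> 1" "\<alpha> \<le> ultranorm U (u - v)"
        "2 * (g w - \<beta> / 4) < g u + g v"
        using exists_far_pair_near_supremum[OF lim[OF \<alpha>] g B w(1), of "\<beta> / 4"] \<beta> by auto
      have "s - \<beta> < g u" "s - \<beta> < g v"
        using uv(4) w(2) g_le_s[OF uv(1)] g_le_s[OF uv(2)] by (simp_all add: field_simps)
      then have "(null_class U u, null_class U v) \<in> T \<times> T"
        using T_I uv by auto
      moreover have "\<alpha> \<le> ?d (null_class U u, null_class U v)"
        using uv(3) by (simp add: vnorm_diff)
      ultimately show "\<alpha> \<le> vdiameter Y T"
        unfolding vdiameter_def using d_le by (intro cSUP_upper2 bdd_aboveI2) blast+
    qed simp
  qed
  then show "vdiameter Y (slice Y \<phi> \<beta>) = 2" by (simp add: T_def)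
qed

end

theorem corollary3p3:
  fixes K :: "complex set" and smul :: "complex \<Rightarrow> 'a::banach \<Rightarrow> 'a"
  assumes "banach_over K smul"
  shows "(\<forall>U. free_ultrafilter U \<longrightarrow> slice_D2P K (ultrapower smul U)) \<longleftrightarrow>
    (\<forall>\<alpha>. 0 < \<alpha> \<and> \<alpha> < 2 \<longrightarrow> (\<lambda>n. C_const TYPE('a) \<alpha> n) \<longlonglongrightarrow> 0)"
proof -
  interpret banach_over K smul by (rule assms)
  have ultrapower: "banach_ultrapower K smul U" if "free_ultrafilter U" for U
    using that by unfold_locales
  show ?thesis
  proof
    assume D2P: "\<forall>U. free_ultrafilter U \<longrightarrow> slice_D2P K (ultrapower smul U)"
    obtain U where U: "free_ultrafilter U" using free_ultrafilter_exists by blast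
    interpret banach_ultrapower K smul U by (rule ultrapower[OF U])
    show "\<forall>\<alpha>. 0 < \<alpha> \<and> \<alpha> < 2 \<longrightarrow> (\<lambda>n. C_const TYPE('a) \<alpha> n) \<longlonglongrightarrow> 0"
    proof (intro allI impI)
      fix \<alpha> :: real assume \<alpha>: "0 < \<alpha> \<and> \<alpha> < 2"
      have "slice_D2P K (ultrapower smul U)" using D2P U by blast
      then show "(\<lambda>n. C_const TYPE('a) \<alpha> n) \<longlonglongrightarrow> 0"
        using \<alpha> slice_D2P_imp_no_gap[of \<alpha>] by (subst C_const_tendsto_0_iff) auto
    qed
  next
    assume lim: "\<forall>\<alpha>. 0 < \<alpha> \<and> \<alpha> < 2 \<longrightarrow> (\<lambda>n. C_const TYPE('a) \<alpha> n) \<longlonglongrightarrow> 0"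
    show "\<forall>U. free_ultrafilter U \<longrightarrow> slice_D2P K (ultrapower smul U)"
    proof (intro allI impI)
      fix U assume "free_ultrafilter U"
      then interpret banach_ultrapower K smul U by (rule ultrapower)
      show "slice_D2P K (ultrapower smul U)"
      proof (rule slice_D2PI)
        fix \<alpha> \<epsilon> :: real assume "0 < \<alpha>" "\<alpha> < 2" "0 < \<epsilon>"
        then show "\<exists>n\<ge>1. \<forall>x::'a. norm x = 1 \<longrightarrow> (\<exists>y\<in>conv_n n (S_set \<alpha>). norm (x - y) < \<epsilon>)"
          using lim C_const_tendsto_0_iff[of \<alpha>] by simp
      qed
    qed
  qed
qed

end
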